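(* Let $\mathcal F$ be a complex Hilbert space and let $\varphi\colon\mathbb R\to B(\mathcal F)$ be positive definite and strongly continuous. Then $\varphi$ is reflection positive (for the group $\mathbb R$, the involution $\tau=-\mathrm{id}_{\mathbb R}$ and the subsemigroup $S=\mathbb R_+=\,]0,\infty[$) if and only if there exists a finite $\mathrm{Herm}(\mathcal F)_+$-valued Borel measure $Q$ on $[0,\infty[$ such that $$\varphi(x)=\int_0^\infty e^{-\lambda|x|}\,dQ(\lambda)\quad\text{for all }x\in\mathbb R.$$
   Context: $\mathrm{Herm}(\mathcal F)_+$ is the cone of bounded positive (semidefinite) operators on $\mathcal F$; a finite $\mathrm{Herm}(\mathcal F)_+$-valued Borel measure $Q$ is a map from Borel sets to $\mathrm{Herm}(\mathcal F)_+$ such that $E\mapsto\langle Q(E)v,v\rangle$ is a finite positive measure for each $v\in\mathcal F$; integrals are understood weakly. A function $\varphi\colon\mathbb R\to B(\mathcal F)$ is positive definite if $\sum_{j,k}\langle\varphi(x_j-x_k)v_k,v_j\rangle\ge0$ for all finite families $x_j\in\mathbb R$, $v_j\in\mathcal F$. It is reflection positive for $(\mathbb R,-\mathrm{id},\mathbb R_+)$ if (RP1) it is positive definite, (RP2) $\varphi(-x)=\varphi(x)$ for all $x$, and (RP3) $\varphi|_{\mathbb R_+}$ is positive definite on the semigroup $(\mathbb R_+,+)$ with the trivial involution $s^\sharp=s$, i.e. $\sum_{j,k}\langle\varphi(s_j+s_k)v_k,v_j\rangle\ge0$ for all finite families $s_j\in\mathbb R_+$, $v_j\in\mathcal F$.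 *)

theory Defs
  imports "HOL-Analysis.Analysis"
begin

text \<open>
  Complex Hilbert spaces. The inner product \<open>cinner\<close> is linear in the first argument and
  conjugate-linear in the second. The classes \<open>real_inner\<close> and \<open>banach\<close> provide the underlying
  real Hilbert space (norm, topology, completeness); the axioms \<open>scaleR_scaleC\<close> and
  \<open>inner_eq_Re_cinner\<close> tie it to the complex structure, so that
  \<open>norm x = sqrt (Re (cinner x x))\<close>, and positive definiteness of \<open>cinner\<close> comes
  from \<open>real_inner\<close>.
\<close>

class complex_hilbert_space = real_inner + banach +
  fixes scaleC :: "complex \<Rightarrow> 'a \<Rightarrow> 'a"  (infixr "*\<^sub>C" 75)
    and cinner :: "'a \<Rightarrow> 'a \<Rightarrow> complex"
  assumes scaleC_add_right: "a *\<^sub>C (x + y) = a *\<^sub>C x + a *\<^sub>C y"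
    and scaleC_add_left: "(a + b) *\<^sub>C x = a *\<^sub>C x + b *\<^sub>C x"
    and scaleC_scaleC: "a *\<^sub>C b *\<^sub>C x = (a * b) *\<^sub>C x"
    and scaleC_one: "1 *\<^sub>C x = x"
    and scaleR_scaleC: "scaleR r x = complex_of_real r *\<^sub>C x"
    and cinner_commute: "cinner x y = cnj (cinner y x)"
    and cinner_add_left: "cinner (x + y) z = cinner x z + cinner y z"
    and cinner_scaleC_left: "cinner (a *\<^sub>C x) y = a * cinner x y"
    and inner_eq_Re_cinner: "inner x y = Re (cinner x y)"

text \<open>Membership in \<open>B(F)\<close>; real-linearity and boundedness are part of \<open>bounded_linear\<close>.\<close>

definition bounded_clinear :: "('f::complex_hilbert_space \<Rightarrow> 'f) \<Rightarrow> bool" where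
  "bounded_clinear T \<longleftrightarrow> bounded_linear T \<and> (\<forall>a v. T (a *\<^sub>C v) = a *\<^sub>C T v)"

definition herm_pos :: "('f::complex_hilbert_space \<Rightarrow> 'f) set" where
  "herm_pos = {T. bounded_clinear T \<and> (\<forall>v w. cinner (T v) w = cinner v (T w)) \<and>
                  (\<forall>v. cinner (T v) v \<in> \<real>\<^sub>\<ge>\<^sub>0)}"

definition positive_definite :: "(real \<Rightarrow> 'f::complex_hilbert_space \<Rightarrow> 'f) \<Rightarrow> bool" where
  "positive_definite \<phi> \<longleftrightarrow>
     (\<forall>(n::nat) (x :: nat \<Rightarrow> real) (v :: nat \<Rightarrow> 'f).
        (\<Sum>j<n. \<Sum>k<n. cinner (\<phi> (x j - x k) (v k)) (v j)) \<in> \<real>\<^sub>\<ge>\<^sub>0)"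

text \<open>
  Positive definiteness of the restriction to the open half-line \<open>]0,\<infinity>[\<close>, regarded as an
  additive semigroup with trivial involution.
\<close>

definition positive_definite_halfline ::
    "(real \<Rightarrow> 'f::complex_hilbert_space \<Rightarrow> 'f) \<Rightarrow> bool" where
  "positive_definite_halfline \<phi> \<longleftrightarrow>
     (\<forall>(n::nat) (s :: nat \<Rightarrow> real) (v :: nat \<Rightarrow> 'f). (\<forall>j<n. s j > 0) \<longrightarrow>
        (\<Sum>j<n. \<Sum>k<n. cinner (\<phi> (s j + s k) (v k)) (v j)) \<in> \<real>\<^sub>\<ge>\<^sub>0)"

text \<open>Reflection positivity for the triple \<open>(\<real>, -id, ]0,\<infinity>[)\<close>.\<close>

definition reflection_positive :: "(real \<Rightarrow> 'f::complex_hilbert_space \<Rightarrow> 'f) \<Rightarrow> bool" where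
  "reflection_positive \<phi> \<longleftrightarrow>
     positive_definite \<phi> \<and> (\<forall>x. \<phi> (- x) = \<phi> x) \<and> positive_definite_halfline \<phi>"

definition strongly_continuous :: "(real \<Rightarrow> 'f::complex_hilbert_space \<Rightarrow> 'f) \<Rightarrow> bool" where
  "strongly_continuous \<phi> \<longleftrightarrow> (\<forall>v. continuous_on UNIV (\<lambda>x. \<phi> x v))"

text \<open>
  A finite \<open>Herm(F)\<^sub>+\<close>-valued measure on the \<open>\<sigma>\<close>-algebra of \<open>M\<close> (the measure carried by \<open>M\<close>
  itself is irrelevant; values of \<open>Q\<close> on nonmeasurable sets are unconstrained). For
  \<open>Q E \<in> herm_pos\<close> the number \<open>cinner (Q E v) v\<close> is real and nonnegative, so neither \<open>Re\<close> nor
  \<open>ennreal\<close> loses information, and finiteness is automatic.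
\<close>

definition herm_pos_measure ::
    "real measure \<Rightarrow> (real set \<Rightarrow> 'f::complex_hilbert_space \<Rightarrow> 'f) \<Rightarrow> bool" where
  "herm_pos_measure M Q \<longleftrightarrow>
     (\<forall>E\<in>sets M. Q E \<in> herm_pos) \<and>
     (\<forall>v. measure_space (space M) (sets M) (\<lambda>E. ennreal (Re (cinner (Q E v) v))))"

definition scalar_measure ::
    "real measure \<Rightarrow> (real set \<Rightarrow> 'f::complex_hilbert_space \<Rightarrow> 'f) \<Rightarrow> 'f \<Rightarrow> real measure" where
  "scalar_measure M Q v =
     measure_of (space M) (sets M) (\<lambda>E. ennreal (Re (cinner (Q E v) v)))"

text \<open>
  The weak integral \<open>T = \<integral> f dQ\<close>: \<open>\<langle>T v, v\<rangle> = \<integral> f dQ\<^sup>v\<close> for all \<open>v\<close>, where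
  \<open>Q\<^sup>v(E) = \<langle>Q(E)v, v\<rangle>\<close>. Since the space is complex,
  polarization shows that these diagonal matrix coefficients determine \<open>T\<close>.
\<close>

definition has_weak_integral ::
    "real measure \<Rightarrow> (real set \<Rightarrow> 'f::complex_hilbert_space \<Rightarrow> 'f) \<Rightarrow> (real \<Rightarrow> real) \<Rightarrow>
     ('f \<Rightarrow> 'f) \<Rightarrow> bool" where
  "has_weak_integral M Q f T \<longleftrightarrow>
     bounded_clinear T \<and>
     (\<forall>v. integrable (scalar_measure M Q v) f \<and>
          cinner (T v) v = complex_of_real (\<integral>l. f l \<partial>scalar_measure M Q v))"

end

theory Submission
  imports Defs "HOL-Probability.Helly_Selection"
begin

text \<open>
  For fixed \<open>v\<close> put \<open>f\<^sub>v(t) = \<langle>\<phi>(t)v, v\<rangle>\<close>. Writing \<open>f\<close> for \<open>f\<^sub>v\<close>, positivity of the kernel \<open>f(s + t)\<close> makes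
  \<open>m \<mapsto> \<Sum>\<^sub>j\<^sub>k c\<^sub>j c\<^sub>k f(s\<^sub>j + s\<^sub>k + m a)\<close> a convex sequence; it is bounded by positive definiteness on the
  group, hence decreasing, so that \<open>f - f(\<cdot> + a)\<close> has a positive kernel again. Iterating, \<open>f\<close> is completely
  monotone, and Hausdorff's moment problem for \<open>n \<mapsto> f(n/q)\<close> yields a measure on \<open>[0,1]\<close>. The image
  of the \<open>q\<close>-th measure under \<open>x \<mapsto> x\<^sup>q\<close> does not depend on \<open>q\<close>, whence a single measure \<open>P\<^sub>v\<close> with
  \<open>f(t) = \<integral> x\<^sup>t dP\<^sub>v\<close>; the substitution \<open>x = e\<^sup>-\<^sup>\<lambda>\<close> turns this into a Laplace transform. Measures on
  \<open>[0,1]\<close> being determined by their moments, the identities expressing that \<open>v \<mapsto> f\<^sub>v(t)\<close> is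
  a quadratic form pass to \<open>v \<mapsto> P\<^sub>v(E)\<close>, and the Riesz representation theorem gives \<open>Q(E)\<close>.

  Conversely, replacing \<open>\<lambda>\<close> by a grid point approximates \<open>\<integral> e\<^sup>-\<^sup>s\<^sup>\<lambda> dQ\<close> weakly by finite sums
  \<open>\<Sum>\<^sub>i e\<^sup>-\<^sup>s\<^sup>i\<^sup>/\<^sup>n Q(E\<^sub>i)\<close>, for which the kernel is visibly positive.
\<close>

section \<open>Complex inner products\<close>

lemma cinner_add_right: "cinner x (y + z) = cinner x y + cinner (x::'f::complex_hilbert_space) z"
  by (metis cinner_add_left cinner_commute complex_cnj_add)

lemma cinner_scaleC_right: "cinner x (a *\<^sub>C y) = cnj a * cinner (x::'f::complex_hilbert_space) y"
  by (metis cinner_commute cinner_scaleC_left complex_cnj_mult)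

lemma cinner_scaleR_left: "cinner (r *\<^sub>R x) y = of_real r * cinner (x::'f::complex_hilbert_space) y"
  by (simp add: scaleR_scaleC cinner_scaleC_left)

lemma cinner_scaleR_right: "cinner x (r *\<^sub>R y) = of_real r * cinner (x::'f::complex_hilbert_space) y"
  by (simp add: scaleR_scaleC cinner_scaleC_right)

lemma cinner_zero_left [simp]: "cinner 0 (y::'f::complex_hilbert_space) = 0"
  using cinner_scaleR_left[of 0 0 y] by simp

lemma cinner_zero_right [simp]: "cinner (x::'f::complex_hilbert_space) 0 = 0"
  using cinner_scaleR_right[of x 0 0] by simp

lemma cinner_sum_left: "cinner (\<Sum>i\<in>I. f i) (y::'f::complex_hilbert_space) = (\<Sum>i\<in>I. cinner (f i) y)"
  by (induction I rule: infinite_finite_induct) (simp_all add: cinner_add_left)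

lemma cinner_sum_right: "cinner (x::'f::complex_hilbert_space) (\<Sum>i\<in>I. f i) = (\<Sum>i\<in>I. cinner x (f i))"
  by (induction I rule: infinite_finite_induct) (simp_all add: cinner_add_right)

lemma cinner_minus_left: "cinner (- x) y = - cinner (x::'f::complex_hilbert_space) y"
  using cinner_scaleR_left[of "-1" x y] by simp

lemma Im_cinner: "Im (cinner x y) = inner (- (\<i> *\<^sub>C x)) (y::'f::complex_hilbert_space)"
  by (simp add: inner_eq_Re_cinner cinner_scaleC_left cinner_minus_left)

lemma inner_ii_ii: "inner (\<i> *\<^sub>C x) (\<i> *\<^sub>C y) = inner x (y::'f::complex_hilbert_space)"
  by (simp add: inner_eq_Re_cinner cinner_scaleC_left cinner_scaleC_right)

lemma ii_ii: "\<i> *\<^sub>C \<i> *\<^sub>C x = - (x::'f::complex_hilbert_space)"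
proof -
  have "\<i> *\<^sub>C \<i> *\<^sub>C x = complex_of_real (-1) *\<^sub>C x"
    by (simp add: scaleC_scaleC)
  also have "\<dots> = - x"
    by (subst scaleR_scaleC[symmetric]) simp
  finally show ?thesis .
qed

lemma scaleC_eq: "a *\<^sub>C x = Re a *\<^sub>R x + Im a *\<^sub>R (\<i> *\<^sub>C (x::'f::complex_hilbert_space))"
proof -
  have "a *\<^sub>C x = (complex_of_real (Re a) + complex_of_real (Im a) * \<i>) *\<^sub>C x"
    by (metis complex_eq mult.commute)
  then show ?thesis by (simp add: scaleC_add_left scaleR_scaleC scaleC_scaleC)
qed

text \<open>The differences are written with \<open>(-1) *\<^sub>C y\<close> and
  \<open>(-\<i>) *\<^sub>C y\<close> so that additivity and the \<open>scaleC\<close> rules alone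
  expand all four terms.\<close>

lemma clinear_cinner_polarization:
  fixes T :: "'f::complex_hilbert_space \<Rightarrow> 'f"
  assumes "bounded_clinear T"
  shows "4 * cinner (T x) y =
     cinner (T (x + y)) (x + y) - cinner (T (x + (-1) *\<^sub>C y)) (x + (-1) *\<^sub>C y)
     + \<i> * cinner (T (x + \<i> *\<^sub>C y)) (x + \<i> *\<^sub>C y)
     - \<i> * cinner (T (x + (-\<i>) *\<^sub>C y)) (x + (-\<i>) *\<^sub>C y)"
proof -
  have "\<And>u v. T (u + v) = T u + T v" "\<And>a u. T (a *\<^sub>C u) = a *\<^sub>C T u"
    using assms by (auto simp: bounded_clinear_def linear_add bounded_linear.linear)
  then show ?thesis
    by (simp add: cinner_add_left cinner_add_right cinner_scaleC_left cinner_scaleC_right algebra_simps)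
qed

text \<open>Polarization recovers every matrix coefficient from the diagonal ones; real parts
  suffice, since the real inner product separates vectors.\<close>

lemma bounded_clinear_eqI:
  fixes S T :: "'f::complex_hilbert_space \<Rightarrow> 'f"
  assumes "bounded_clinear S" "bounded_clinear T" and diag: "\<And>v. cinner (S v) v = cinner (T v) v"
  shows "S = T"
proof
  fix x
  have "4 * cinner (S x) y = 4 * cinner (T x) y" for y
    unfolding clinear_cinner_polarization[OF assms(1)] clinear_cinner_polarization[OF assms(2)] diag ..
  then have "inner (S x) y = inner (T x) y" for y by (simp add: inner_eq_Re_cinner)
  from this[of "S x - T x"] have "inner (S x - T x) (S x - T x) = 0" by (simp add: inner_diff_left)
  then show "S x = T x" by simp
qed

section \<open>Quadratic forms and positive operators\<close>

text \<open>The representing vector minimizes \<open>J x = inner x x - 2 * l x\<close>: completeness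
  yields a minimizer, and the first variation vanishes there.\<close>

theorem Riesz_representation:
  fixes l :: "'f::{real_inner,banach} \<Rightarrow> real"
  assumes "bounded_linear l"
  shows "\<exists>x. \<forall>w. l w = inner x w"
proof -
  interpret l: bounded_linear l by fact
  define J where "J x = inner x x - 2 * l x" for x
  obtain C where C: "\<And>x. norm (l x) \<le> norm x * C" using l.bounded by blast
  have J_ge: "J x \<ge> - (C^2)" for x
  proof -
    have "l x \<le> norm x * C" using C[of x] by simp
    moreover have "(norm x - C)^2 \<ge> 0" by simp
    ultimately show ?thesis
      unfolding J_def dot_square_norm by (simp add: power2_eq_square algebra_simps)
  qed
  define d where "d = Inf (range J)"
  have bdd: "bdd_below (range J)" using J_ge by (auto intro!: bdd_belowI)
  have d_le: "d \<le> J x" for x unfolding d_def using bdd by (auto intro: cInf_lower)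
  have "\<exists>x. J x < d + 1 / real (Suc n)" for n
  proof -
    have "Inf (range J) < d + 1 / real (Suc n)" by (simp add: d_def)
    then show ?thesis using cInf_lessD[of "range J"] by auto
  qed
  then obtain X where X: "\<And>n. J (X n) < d + 1 / real (Suc n)" by metis
  \<comment> \<open>Parallelogram law: the linear parts cancel, and since \<open>J\<close> at the
    midpoint is at least \<open>d\<close>, a minimizing sequence is Cauchy.\<close>
  have par: "(norm (x - y))^2 = 2 * J x + 2 * J y - 4 * J ((1/2) *\<^sub>R (x + y))" for x y
    unfolding J_def power2_norm_eq_inner
    by (simp add: l.add l.scaleR inner_add_left inner_add_right inner_diff_left inner_diff_right inner_commute algebra_simps)
  have dist: "(norm (X m - X n))^2 < 2 / real (Suc m) + 2 / real (Suc n)" for m n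
    using par[of "X m" "X n"] X[of m] X[of n] d_le[of "(1/2) *\<^sub>R (X m + X n)"] by simp
  have "Cauchy X"
  proof (rule CauchyI)
    fix e :: real assume e: "0 < e"
    obtain N where N: "1 / real (Suc N) < e^2 / 4"
      using e nat_approx_posE[of "e^2/4"] by (metis zero_less_power zero_less_divide_iff zero_less_numeral)
    have "norm (X m - X n) < e" if "m \<ge> N" "n \<ge> N" for m n
    proof -
      have "1 / real (Suc m) \<le> 1 / real (Suc N)" "1 / real (Suc n) \<le> 1 / real (Suc N)"
        using that by (auto simp: frac_le)
      then have "(norm (X m - X n))^2 < e^2" using dist[of m n] N by simp
      then show ?thesis using e by (simp add: power_less_imp_less_base)
    qed
    then show "\<exists>M. \<forall>m\<ge>M. \<forall>n\<ge>M. norm (X m - X n) < e" by blast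
  qed
  then obtain x where x: "X \<longlonglongrightarrow> x" using Cauchy_convergent_iff convergent_def by blast
  have "(\<lambda>n. J (X n)) \<longlonglongrightarrow> J x" unfolding J_def by (intro tendsto_intros l.tendsto x)
  moreover have "(\<lambda>n. d + 1 / real (Suc n)) \<longlonglongrightarrow> d + 0"
    by (intro tendsto_intros LIMSEQ_Suc[OF lim_1_over_n])
  ultimately have "J x \<le> d + 0"
    by (rule LIMSEQ_le) (use X less_imp_le in blast)
  then have min: "J x \<le> J y" for y using d_le[of y] by simp
  have "l w = inner x w" for w
  proof (rule ccontr)
    define g where "g = inner x w - l w"
    assume "l w \<noteq> inner x w"
    then have g: "g \<noteq> 0" by (simp add: g_def)
    have *: "0 \<le> 2 * t * g + t^2 * inner w w" for t
      using min[of "x + t *\<^sub>R w"]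
      by (simp add: J_def g_def l.add l.scaleR inner_add_left inner_add_right inner_commute power2_eq_square algebra_simps)
    have w: "inner w w + 1 > 0" by (simp add: add_nonneg_pos)
    \<comment> \<open>The optimal \<open>t\<close> would be \<open>- g / inner w w\<close>; the 1
      added to the denominator covers \<open>w = 0\<close> and still makes the quadratic
      negative.\<close>
    have "0 \<le> 2 * (- g / (inner w w + 1)) * g + (- g / (inner w w + 1))^2 * inner w w" by (rule *)
    also have "\<dots> = - (g^2 * (inner w w + 2)) / (inner w w + 1)^2"
      using w by (simp add: power2_eq_square divide_simps) (simp add: algebra_simps)
    also have "\<dots> < 0"
    proof -
      have "g^2 * (inner w w + 2) > 0" using w g by (intro mult_pos_pos) auto
      then show ?thesis using w by (simp add: divide_less_0_iff zero_less_power)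
    qed
    finally show False by simp
  qed
  then show ?thesis by blast
qed

text \<open>All identities are linear in the values of \<open>q\<close>, so that they can be
  inherited from moments. With \<open>scale\<close>, the hypotheses \<open>add\<close> and
  \<open>pos_scale\<close> say that the polarization \<open>b\<close> is additive and positively
  homogeneous; Riesz turns each \<open>b x\<close> into a vector, and \<open>ii\<close> makes the
  resulting real-linear map complex-linear.\<close>

theorem herm_pos_of_quadratic_form:
  fixes q :: "'f::complex_hilbert_space \<Rightarrow> real"
  assumes nonneg: "\<And>v. 0 \<le> q v"
    and bounded: "\<And>v. q v \<le> C * (norm v)^2"
    and ii: "\<And>v. q (\<i> *\<^sub>C v) = q v"
    and scale: "\<And>r v. q (r *\<^sub>R v) = r^2 * q v"
    and add: "\<And>u v w. q (u + v + w) + q u + q v + q w = q (u + v) + q (v + w) + q (u + w)"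
    and pos_scale: "\<And>r u v. 0 \<le> r \<Longrightarrow> q (u + r *\<^sub>R v) + r * q u + r * q v = q u + r^2 * q v + r * q (u + v)"
  shows "\<exists>T. T \<in> herm_pos \<and> (\<forall>v. cinner (T v) v = of_real (q v))"
proof -
  define b where "b x y = (q (x + y) - q x - q y) / 2" for x y
  have sym: "b x y = b y x" for x y by (simp add: b_def add.commute)
  have addr: "b x (y + z) = b x y + b x z" for x y z
    unfolding b_def using add[of x y z] by (simp add: field_simps)
  have q0: "q 0 = 0" using scale[of 0 0] by simp
  have bm: "b x (- y) = - b x y" for x y
  proof -
    have "b x 0 = 0" by (simp add: b_def q0)
    then show ?thesis using addr[of x y "-y"] by simp
  qed
  have bp: "b x (r *\<^sub>R y) = r * b x y" if "r \<ge> 0" for x y r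
    unfolding b_def using pos_scale[OF that, of x y] scale[of r y] by (simp add: field_simps)
  have bs: "b x (r *\<^sub>R y) = r * b x y" for x y r
    using bp[of r x y] bp[of "-r" x "y"] bm[of x "r *\<^sub>R y"] by (cases "r \<ge> 0") auto
  have bq: "b x x = q x" for x
    using scale[of 2 x] unfolding b_def by (simp add: scaleR_2)
  \<comment> \<open>A crude substitute for Cauchy-Schwarz: estimated on unit vectors from
    \<open>bounded\<close>, then extended by homogeneity.\<close>
  have CS: "\<bar>b x y\<bar> \<le> 2 * \<bar>C\<bar> * norm x * norm y" for x y
  proof -
    have unit: "\<bar>b x y\<bar> \<le> 2 * \<bar>C\<bar>" if "norm x = 1" "norm y = 1" for x y
    proof -
      have q1: "q z \<le> \<bar>C\<bar> * (norm z)^2" for z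
        using bounded[of z] by (meson abs_ge_self mult_right_mono order_trans zero_le_power2)
      have "norm (x + y) \<le> 2" using norm_triangle_ineq[of x y] that by simp
      then have "(norm (x + y))^2 \<le> 2^2" by (rule power_mono) simp
      then have "\<bar>C\<bar> * (norm (x + y))^2 \<le> \<bar>C\<bar> * 2^2" by (intro mult_left_mono) auto
      then have "q (x + y) \<le> 4 * \<bar>C\<bar>" using q1[of "x+y"] by simp
      then show ?thesis unfolding b_def
        using nonneg[of "x+y"] nonneg[of x] nonneg[of y] q1[of x] q1[of y] that by (simp add: abs_le_iff)
    qed
    have bsl: "b (r *\<^sub>R x) y = r * b x y" for r x y by (metis sym bs)
    show ?thesis
    proof (cases "x = 0 \<or> y = 0")
      case True
      then show ?thesis by (auto simp: b_def q0)
    next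
      case False
      have "b x y = norm x * norm y * b (x /\<^sub>R norm x) (y /\<^sub>R norm y)"
        using False by (simp add: bs bsl field_simps)
      then show ?thesis
        using unit[of "x /\<^sub>R norm x" "y /\<^sub>R norm y"] False by (simp add: abs_mult mult_left_mono mult.commute)
    qed
  qed
  have bl: "bounded_linear (b x)" for x
    by (rule bounded_linear_intro[where K="2 * \<bar>C\<bar> * norm x"])
      (use addr bs CS[of x] in \<open>auto simp: mult.commute mult.left_commute\<close>)
  then have "\<forall>x. \<exists>y. \<forall>w. b x w = inner y w" using Riesz_representation by blast
  then obtain T where T: "\<And>x w. b x w = inner (T x) w" by metis
  have inj: "y = z" if "\<And>w. inner y w = inner z w" for y z :: 'f
  proof -
    have "inner (y - z) (y - z) = 0" using that[of "y - z"] by (simp add: inner_diff_left)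
    then show ?thesis by simp
  qed
  have Tadd: "T (x + y) = T x + T y" for x y
    by (rule inj) (metis T addr inner_add_left sym)
  have TscaleR: "T (r *\<^sub>R x) = r *\<^sub>R T x" for r x
    by (rule inj) (metis T bs inner_scaleR_left sym)
  have bi: "b (\<i> *\<^sub>C x) (\<i> *\<^sub>C y) = b x y" for x y
    unfolding b_def by (simp add: ii flip: scaleC_add_right)
  \<comment> \<open>By \<open>bi\<close> and \<open>ii_ii\<close>, multiplication by
    \<open>\<i>\<close> is skew for \<open>b\<close>, just as it is for the real inner
    product.\<close>
  have Ti: "T (\<i> *\<^sub>C x) = \<i> *\<^sub>C T x" for x
  proof (rule inj)
    fix w
    have "inner (T (\<i> *\<^sub>C x)) w = b (\<i> *\<^sub>C x) w" by (simp add: T)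
    also have "\<dots> = b (\<i> *\<^sub>C \<i> *\<^sub>C x) (\<i> *\<^sub>C w)" by (simp only: bi)
    also have "\<dots> = - b x (\<i> *\<^sub>C w)" using bm sym by (metis ii_ii)
    also have "\<dots> = - inner (T x) (\<i> *\<^sub>C w)" by (simp add: T)
    also have "\<dots> = inner (\<i> *\<^sub>C \<i> *\<^sub>C T x) (\<i> *\<^sub>C w)" by (simp add: ii_ii)
    also have "\<dots> = inner (\<i> *\<^sub>C T x) w" by (simp only: inner_ii_ii)
    finally show "inner (T (\<i> *\<^sub>C x)) w = inner (\<i> *\<^sub>C T x) w" .
  qed
  have TscaleC: "T (a *\<^sub>C x) = a *\<^sub>C T x" for a x
    by (simp add: scaleC_eq[of a] Tadd TscaleR Ti)
  have Tbound: "norm (T x) \<le> norm x * (2 * \<bar>C\<bar>)" for x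
  proof -
    have "norm (T x) * norm (T x) = b x (T x)" by (simp add: T flip: dot_square_norm power2_eq_square)
    also have "\<dots> \<le> (norm x * (2 * \<bar>C\<bar>)) * norm (T x)" using CS[of x "T x"] by (simp add: mult.commute mult.left_commute abs_le_iff)
    finally show ?thesis
      by (cases "T x = 0") auto
  qed
  have bcl: "bounded_clinear T"
    unfolding bounded_clinear_def using Tadd TscaleR Tbound TscaleC
    by (auto intro!: bounded_linear_intro[where K="2 * \<bar>C\<bar>"])
  have Thermi: "inner (T x) y = inner x (T y)" for x y
    by (metis T sym inner_commute)
  have Therm: "cinner (T x) y = cinner x (T y)" for x y
  proof (rule complex_eqI)
    show "Re (cinner (T x) y) = Re (cinner x (T y))" using Thermi by (simp add: inner_eq_Re_cinner)
    show "Im (cinner (T x) y) = Im (cinner x (T y))"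
      using Thermi[of "- (\<i> *\<^sub>C x)" y] TscaleR[of "-1" "\<i> *\<^sub>C x"] by (simp add: Im_cinner Ti)
  qed
  have Tq: "cinner (T v) v = of_real (q v)" for v
  proof (rule complex_eqI)
    show "Re (cinner (T v) v) = Re (of_real (q v))" by (simp add: T[symmetric] bq flip: inner_eq_Re_cinner)
    have "Im (cinner (T v) v) = Im (cnj (cinner (T v) v))" by (metis Therm cinner_commute)
    then show "Im (cinner (T v) v) = Im (of_real (q v))" by simp
  qed
  have "T \<in> herm_pos" unfolding herm_pos_def using bcl Therm Tq nonneg by (auto simp: nonneg_Reals_of_real_iff)
  then show ?thesis using Tq by blast
qed

section \<open>The Hausdorff moment problem\<close>

lemma abs_cts_step_le_1: "a < b \<Longrightarrow> \<bar>cts_step a b x\<bar> \<le> 1"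
  by (auto simp: cts_step_def abs_le_iff divide_le_eq le_divide_eq)

text \<open>Signed combinations of measures let linear identities between moments pass to the measures
  without forming differences of measures.\<close>

lemma signed_moments_zero:
  fixes M :: "'i \<Rightarrow> real measure" and a :: "'i \<Rightarrow> real"
  assumes I: "finite I"
    and fin: "\<And>i. i \<in> I \<Longrightarrow> finite_measure (M i)"
    and sets: "\<And>i. i \<in> I \<Longrightarrow> sets (M i) = sets borel"
    and supp: "\<And>i. i \<in> I \<Longrightarrow> AE x in M i. x \<in> {0..1}"
    and moments: "\<And>n. (\<Sum>i\<in>I. a i * (\<integral>x. x ^ n \<partial>M i)) = 0"
    and E: "E \<in> sets borel"
  shows "(\<Sum>i\<in>I. a i * measure (M i) E) = 0"
proof -
  \<comment> \<open>The signed functional \<open>B\<close> vanishes on polynomials, hence by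
    Weierstrass on continuous functions; ramps then give half-lines, and a pi-lambda argument gives
    Borel sets.\<close>
  define B where "B f = (\<Sum>i\<in>I. a i * (\<integral>x. f x \<partial>M i))" for f :: "real \<Rightarrow> real"
  have integ: "integrable (M i) f" if i: "i \<in> I" and f: "continuous_on UNIV f" for f :: "real \<Rightarrow> real" and i
  proof -
    interpret finite_measure "M i" using fin i .
    have "compact (f ` {0..1})"
      by (rule compact_continuous_image[OF continuous_on_subset[OF f]]) auto
    then have "bounded (f ` {0..1})" by (rule compact_imp_bounded)
    then obtain C where C: "\<And>x. x \<in> {0..1} \<Longrightarrow> norm (f x) \<le> C"
      unfolding bounded_iff by blast
    have "f \<in> borel_measurable (M i)"
      unfolding measurable_cong_sets[OF sets[OF i] refl] by (rule borel_measurable_continuous_onI[OF f])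
    moreover have "AE x in M i. norm (f x) \<le> C" using supp[OF i] by eventually_elim (rule C)
    ultimately show ?thesis by (intro integrable_const_bound)
  qed
  have B_poly: "B g = 0" if g: "real_polynomial_function g" for g
  proof -
    obtain c n where gc: "g = (\<lambda>x. \<Sum>k\<le>n. c k * x ^ k)"
      using g by (auto simp: real_polynomial_function_iff_sum)
    have "B g = (\<Sum>i\<in>I. a i * (\<Sum>k\<le>n. c k * (\<integral>x. x ^ k \<partial>M i)))"
      unfolding B_def gc
    proof (intro sum.cong refl arg_cong2[where f="(*)"])
      fix i assume i: "i \<in> I"
      have "integrable (M i) (\<lambda>x. c k * x ^ k)" for k
        by (intro integ[OF i] continuous_intros)
      then show "(\<integral>x. (\<Sum>k\<le>n. c k * x ^ k) \<partial>M i) = (\<Sum>k\<le>n. c k * (\<integral>x. x ^ k \<partial>M i))"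
        by (subst Bochner_Integration.integral_sum) simp_all
    qed
    also have "\<dots> = (\<Sum>k\<le>n. c k * (\<Sum>i\<in>I. a i * (\<integral>x. x ^ k \<partial>M i)))"
      unfolding sum_distrib_left by (subst sum.swap) (simp add: mult.left_commute)
    also have "\<dots> = 0" by (simp add: moments)
    finally show ?thesis .
  qed
  have B_cont: "B f = 0" if f: "continuous_on UNIV f" for f
  proof -
    define D where "D = (\<Sum>i\<in>I. \<bar>a i\<bar> * measure (M i) (space (M i)))"
    have *: "\<bar>B f\<bar> \<le> e * D" if e: "e > 0" for e
    proof -
      obtain g where g: "real_polynomial_function g" and fg: "\<And>x. x \<in> {0..1} \<Longrightarrow> \<bar>f x - g x\<bar> < e"
        using Stone_Weierstrass_real_polynomial_function[of "{0..1::real}" f e] e f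
        by (metis compact_Icc continuous_on_subset subset_UNIV)
      have cg: "continuous_on UNIV g"
        using g by (simp add: continuous_on_polymonial_function real_polynomial_function_eq)
      have "B f = B f - B g" using B_poly[OF g] by simp
      also have "\<dots> = (\<Sum>i\<in>I. a i * (\<integral>x. f x - g x \<partial>M i))"
        unfolding B_def sum_subtractf[symmetric]
        by (intro sum.cong refl) (simp add: integ f cg right_diff_distrib)
      also have "\<bar>\<dots>\<bar> \<le> (\<Sum>i\<in>I. \<bar>a i\<bar> * (e * measure (M i) (space (M i))))"
      proof (rule order_trans[OF sum_abs], rule sum_mono, unfold abs_mult, rule mult_left_mono)
        fix i assume i: "i \<in> I"
        interpret finite_measure "M i" using fin i .
        have int: "integrable (M i) (\<lambda>x. f x - g x)" using integ[OF i f] integ[OF i cg] by simp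
        have "\<bar>\<integral>x. f x - g x \<partial>M i\<bar> \<le> (\<integral>x. \<bar>f x - g x\<bar> \<partial>M i)" by (rule integral_abs_bound)
        also have "\<dots> \<le> (\<integral>x. e \<partial>M i)"
        proof (rule integral_mono_AE)
          show "AE x in M i. \<bar>f x - g x\<bar> \<le> e"
            using supp[OF i] by eventually_elim (use fg less_imp_le in blast)
        qed (use int in auto)
        finally show "\<bar>\<integral>x. f x - g x \<partial>M i\<bar> \<le> e * measure (M i) (space (M i))" by (simp add: mult.commute)
      qed simp
      also have "\<dots> = e * D" by (simp add: D_def sum_distrib_left mult.left_commute)
      finally show ?thesis .
    qed
    have D: "D \<ge> 0" unfolding D_def by (intro sum_nonneg) simp
    have "\<bar>B f\<bar> \<le> 0"
    proof (rule field_le_epsilon)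
      fix e :: real assume e: "0 < e"
      have "\<bar>B f\<bar> \<le> e / (D + 1) * D" by (rule *) (use D e in auto)
      also have "\<dots> \<le> 0 + e" using D e by (simp add: field_simps)
      finally show "\<bar>B f\<bar> \<le> 0 + e" .
    qed
    then show ?thesis by simp
  qed
  have meas: "E \<in> sets (M i)" if "i \<in> I" "E \<in> sets borel" for i E using sets that by simp
  have atMost: "(\<Sum>i\<in>I. a i * measure (M i) {..t}) = 0" for t
  proof -
    define d where "d n = 1 / real (Suc n)" for n
    have d_pos: "d n > 0" for n by (simp add: d_def)
    have d_lim: "d \<longlonglongrightarrow> 0" unfolding d_def by (rule LIMSEQ_Suc[OF lim_1_over_n])
    \<comment> \<open>Continuous ramps from 1 at \<open>t\<close> down to 0 at
      \<open>t + d n\<close>, converging pointwise to the indicator of \<open>{..t}\<close>.\<close>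
    define g where "g n = cts_step t (t + d n)" for n
    have g_cont: "continuous_on UNIV (g n)" for n
      unfolding g_def
      by (rule uniformly_continuous_imp_continuous, rule cts_step_uniformly_continuous) (simp add: d_pos)
    have g_lim: "(\<lambda>n. g n x) \<longlonglongrightarrow> indicator {..t} x" for x
    proof (cases "x \<le> t")
      case True
      then show ?thesis by (simp add: g_def cts_step_def)
    next
      case False
      then have "eventually (\<lambda>n. d n < x - t) sequentially"
        using order_tendstoD(2)[OF d_lim, of "x - t"] by simp
      then have "eventually (\<lambda>n. g n x = 0) sequentially"
        by eventually_elim (use False in \<open>simp add: g_def cts_step_def\<close>)
      then show ?thesis using False by (simp add: tendsto_eventually)
    qed
    have "(\<lambda>n. B (g n)) \<longlonglongrightarrow> (\<Sum>i\<in>I. a i * measure (M i) {..t})"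
      unfolding B_def
    proof (rule tendsto_sum, rule tendsto_mult[OF tendsto_const])
      fix i assume i: "i \<in> I"
      interpret finite_measure "M i" using fin i .
      have sp: "space (M i) = UNIV" using sets_eq_imp_space_eq[OF sets[OF i]] by simp
      have m: "{..t} \<in> sets (M i)" by (rule meas[OF i]) simp
      have "(\<lambda>n. \<integral>x. g n x \<partial>M i) \<longlonglongrightarrow> (\<integral>x. indicator {..t} x \<partial>M i)"
      proof (rule integral_dominated_convergence[where w="\<lambda>_. 1"])
        show "g n \<in> borel_measurable (M i)" for n
          using integ[OF i g_cont] by (rule borel_measurable_integrable)
        show "indicator {..t} \<in> borel_measurable (M i)" using m by (rule borel_measurable_indicator)
        show "AE x in M i. norm (g n x) \<le> 1" for n
          unfolding g_def by (rule AE_I2) (simp add: abs_cts_step_le_1 d_pos)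
        show "AE x in M i. (\<lambda>n. g n x) \<longlonglongrightarrow> indicator {..t} x"
          by (rule AE_I2) (rule g_lim)
        show "integrable (M i) (\<lambda>_. 1)" by (rule integrable_const)
      qed
      then show "(\<lambda>n. \<integral>x. g n x \<partial>M i) \<longlonglongrightarrow> measure (M i) {..t}" by (simp add: sp)
    qed
    then show ?thesis using B_cont[OF g_cont] by (simp add: LIMSEQ_const_iff)
  qed
  \<comment> \<open>The zeroth moments are the total masses, which the complement step
    requires.\<close>
  have univ: "(\<Sum>i\<in>I. a i * measure (M i) UNIV) = 0"
    using moments[of 0] sets_eq_imp_space_eq[OF sets] by simp
  have "Int_stable (range (\<lambda>t::real. {..t}))" by (auto simp: Int_stable_def)
  moreover have "range (\<lambda>t::real. {..t}) \<subseteq> Pow UNIV" by simp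
  moreover have "E \<in> sigma_sets UNIV (range (\<lambda>t::real. {..t}))"
    using E by (simp add: borel_eq_atMost)
  ultimately show ?thesis
  proof (induction rule: sigma_sets_induct_disjoint)
    case (basic A)
    then show ?case using atMost by auto
  next
    case empty
    show ?case by simp
  next
    case (compl A)
    then have A: "A \<in> sets borel" by (simp add: borel_eq_atMost)
    have "measure (M i) (UNIV - A) = measure (M i) UNIV - measure (M i) A" if "i \<in> I" for i
      using finite_measure.finite_measure_compl[OF fin[OF that] meas[OF that A]]
        sets_eq_imp_space_eq[OF sets[OF that]] by simp
    then have "(\<Sum>i\<in>I. a i * measure (M i) (UNIV - A)) =
       (\<Sum>i\<in>I. a i * measure (M i) UNIV) - (\<Sum>i\<in>I. a i * measure (M i) A)"
      by (simp add: right_diff_distrib sum_subtractf)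
    then show ?case using compl univ by simp
  next
    case (union A)
    have A: "range A \<subseteq> sets borel" using union by (auto simp: borel_eq_atMost)
    have "(\<lambda>n. measure (M i) (A n)) sums measure (M i) (\<Union>n. A n)" if "i \<in> I" for i
    proof (rule finite_measure.finite_measure_UNION[OF fin[OF that] _ union.hyps(1)])
      show "range A \<subseteq> sets (M i)" using A sets[OF that] by simp
    qed
    then have "(\<lambda>n. \<Sum>i\<in>I. a i * measure (M i) (A n)) sums (\<Sum>i\<in>I. a i * measure (M i) (\<Union>n. A n))"
      by (intro sums_sum sums_mult)
    then show ?case using union.IH by (simp add: sums_iff)
  qed
qed

text \<open>\<open>alternating_diff c l k\<close> is the value at \<open>x\<^sup>k (1 - x)\<^sup>l\<close> of the linear functional \<open>x\<^sup>n \<mapsto> c\<^sub>n\<close>. The terms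
  with \<open>l = N - k\<close>, weighted by binomial coefficients, are the masses at \<open>k/N\<close> of the measures
  approximating the solution of the moment problem.\<close>

fun alternating_diff :: "(nat \<Rightarrow> real) \<Rightarrow> nat \<Rightarrow> nat \<Rightarrow> real" where
  "alternating_diff c 0 k = c k"
| "alternating_diff c (Suc l) k = alternating_diff c l k - alternating_diff c l (Suc k)"

text \<open>Apply the functional to \<open>x^j * (x + (1 - x))^N = x^j\<close>; the induction is
  Pascal's rule. The offset \<open>j\<close> serves the factorial moments below.\<close>

lemma sum_binomial_alternating_diff:
  "(\<Sum>k\<le>N. real (N choose k) * alternating_diff c (N - k) (k + j)) = c j"
proof (induction N)
  case 0
  show ?case by simp
next
  case (Suc N)
  let ?D = "alternating_diff c"
  have "(\<Sum>k\<le>Suc N. real (Suc N choose k) * ?D (Suc N - k) (k + j)) =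
      ?D (Suc N) j + (\<Sum>k\<le>N. real (Suc N choose Suc k) * ?D (N - k) (Suc k + j))"
    by (subst sum.atMost_Suc_shift) simp
  also have "\<dots> = (?D (Suc N) j + (\<Sum>k\<le>N. real (N choose Suc k) * ?D (N - k) (Suc k + j)))
      + (\<Sum>k\<le>N. real (N choose k) * ?D (N - k) (Suc k + j))"
    by (simp add: distrib_right sum.distrib)
  also have "?D (Suc N) j + (\<Sum>k\<le>N. real (N choose Suc k) * ?D (N - k) (Suc k + j)) =
      (\<Sum>k\<le>Suc N. real (N choose k) * ?D (Suc N - k) (k + j))"
    by (subst sum.atMost_Suc_shift) simp
  also have "\<dots> = (\<Sum>k\<le>N. real (N choose k) * ?D (Suc N - k) (k + j))" by simp
  also have "\<dots> + (\<Sum>k\<le>N. real (N choose k) * ?D (N - k) (Suc k + j)) =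
      (\<Sum>k\<le>N. real (N choose k) * ?D (N - k) (k + j))"
    unfolding sum.distrib[symmetric] by (intro sum.cong refl) (simp add: Suc_diff_le algebra_simps)
  finally show ?case using Suc.IH by simp
qed

text \<open>The factorial moments of the approximating masses are exact: \<open>(N choose k) * (k
  choose j) = (N choose j) * (N - j choose (k - j))\<close> reduces the sum to the previous identity
  at level \<open>N - j\<close>.\<close>

lemma sum_binomial_moment:
  assumes "j \<le> N"
  shows "(\<Sum>k\<le>N. real (N choose k) * alternating_diff c (N - k) k * real (k choose j)) = real (N choose j) * c j"
proof -
  have "(\<Sum>k\<le>N. real (N choose k) * alternating_diff c (N - k) k * real (k choose j)) =
      (\<Sum>k=j..N. real (N choose k) * alternating_diff c (N - k) k * real (k choose j))"
    by (rule sum.mono_neutral_right) auto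
  also have "\<dots> = (\<Sum>i\<le>N - j. real (N choose (i + j)) * alternating_diff c (N - (i + j)) (i + j) * real ((i + j) choose j))"
    using assms by (intro sum.reindex_bij_witness[where i="\<lambda>i. i + j" and j="\<lambda>k. k - j"]) auto
  also have "\<dots> = (\<Sum>i\<le>N - j. real (N choose j) * (real (N - j choose i) * alternating_diff c (N - j - i) (i + j)))"
  proof (rule sum.cong[OF refl])
    fix i assume "i \<in> {..N - j}"
    then have "(N choose (i + j)) * ((i + j) choose j) = (N choose j) * ((N - j) choose i)"
      using choose_mult[of j "i + j" N] assms by simp
    then have "real (N choose (i + j)) * real ((i + j) choose j) = real (N choose j) * real ((N - j) choose i)"
      by (metis of_nat_mult)
    then show "real (N choose (i + j)) * alternating_diff c (N - (i + j)) (i + j) * real ((i + j) choose j) =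
        real (N choose j) * (real (N - j choose i) * alternating_diff c (N - j - i) (i + j))"
      by (simp add: mult.commute mult.left_commute add.commute)
  qed
  also have "\<dots> = real (N choose j) * c j"
    by (simp only: sum_distrib_left[symmetric] sum_binomial_alternating_diff)
  finally show ?thesis .
qed

text \<open>The induction trades a power of \<open>k/N\<close> for a binomial coefficient, by
  \<open>k (k choose j) = (j + 1) (k choose (j + 1)) + j (k choose j)\<close>.\<close>

lemma binomial_power_moment_tendsto:
  "(\<lambda>N. (\<Sum>k\<le>N. real (N choose k) * alternating_diff c (N - k) k * real (k choose j) * (real k / real N) ^ r)
      / real (N choose j)) \<longlonglongrightarrow> c (j + r)"
\<comment> \<open>\<open>j\<close> is generalized because lowering the power by one raises the
  factorial order by one.\<close>
proof (induction r arbitrary: j)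
  case 0
  have "\<forall>\<^sub>F N in sequentially. (\<Sum>k\<le>N. real (N choose k) * alternating_diff c (N - k) k * real (k choose j)) / real (N choose j) = c j"
    using eventually_ge_at_top[of j] by eventually_elim (simp add: sum_binomial_moment)
  then show ?case by (simp add: tendsto_eventually)
next
  case (Suc r)
  let ?w = "\<lambda>N k. real (N choose k) * alternating_diff c (N - k) k"
  define m where "m j r = (\<lambda>N. (\<Sum>k\<le>N. ?w N k * real (k choose j) * (real k / real N) ^ r) / real (N choose j))" for j r
  have rec: "m j (Suc r) N = (1 - real j / real N) * m (Suc j) r N + real j / real N * m j r N" if N: "N > j" for N
  proof -
    have k: "real k * real (k choose j) = real (Suc j) * real (k choose Suc j) + real j * real (k choose j)" for k
    proof (cases "j \<le> k")
      case True
      have "(k choose j) * (k - j) = Suc j * (k choose Suc j)"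
        by (metis binomial_absorb_comp binomial_absorption mult.commute Suc_times_binomial_add True binomial_symmetric)
      then have "real (k choose j) * (real k - real j) = real (Suc j) * real (k choose Suc j)"
        using True by (metis of_nat_diff of_nat_mult)
      then show ?thesis by (simp add: algebra_simps)
    next
      case False
      then show ?thesis by (simp add: binomial_eq_0)
    qed
    have Nc: "real (Suc j) * real (N choose Suc j) = (real N - real j) * real (N choose j)"
      using k[of N] by (simp add: algebra_simps)
    have c0: "real (N choose j) > 0" "real (N choose Suc j) > 0" using N by simp_all
    have "(\<Sum>k\<le>N. ?w N k * real (k choose j) * (real k / real N) ^ Suc r) =
      (\<Sum>k\<le>N. ?w N k * (real k * real (k choose j)) * (real k / real N) ^ r) / real N"
      unfolding sum_divide_distrib by (intro sum.cong refl) (simp add: field_simps)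
    also have "\<dots> = (real (Suc j) * (\<Sum>k\<le>N. ?w N k * real (k choose Suc j) * (real k / real N) ^ r)
        + real j * (\<Sum>k\<le>N. ?w N k * real (k choose j) * (real k / real N) ^ r)) / real N"
      unfolding k sum_distrib_left sum.distrib[symmetric]
      by (intro arg_cong2[where f="(/)"] sum.cong refl) (simp add: algebra_simps)
    also have "\<dots> = (real (Suc j) * (m (Suc j) r N * real (N choose Suc j)) + real j * (m j r N * real (N choose j))) / real N"
      unfolding m_def using c0 by simp
    also have "\<dots> = (real (Suc j) * real (N choose Suc j) * m (Suc j) r N + real j * (m j r N * real (N choose j))) / real N"
      by (simp add: mult.commute mult.left_commute)
    also have "\<dots> = ((1 - real j / real N) * m (Suc j) r N + real j / real N * m j r N) * real (N choose j)"
      unfolding Nc using N by (simp add: field_simps)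
    finally show ?thesis unfolding m_def[of j "Suc r"] using c0 by simp
  qed
  \<comment> \<open>In the recursion the term of unchanged order has weight \<open>j / N\<close> and
    disappears, leaving \<open>c (Suc j + r)\<close>.\<close>
  have "(\<lambda>N. real j / real N) \<longlonglongrightarrow> 0"
    by (rule lim_const_over_n)
  then have "(\<lambda>N. (1 - real j / real N) * m (Suc j) r N + real j / real N * m j r N)
      \<longlonglongrightarrow> (1 - 0) * c (Suc j + r) + 0 * c (j + r)"
    using Suc.IH[of "Suc j"] Suc.IH[of j] unfolding m_def by (intro tendsto_intros)
  moreover have "\<forall>\<^sub>F N in sequentially. (1 - real j / real N) * m (Suc j) r N + real j / real N * m j r N = m j (Suc r) N"
    using eventually_gt_at_top[of j] by eventually_elim (rule rec[symmetric])
  ultimately have "m j (Suc r) \<longlonglongrightarrow> c (j + Suc r)"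
    by (simp add: tendsto_cong)
  then show ?case by (simp only: m_def)
qed

text \<open>The masses \<open>w N k\<close> at \<open>k / N\<close> form probability measures on
  [0,1]. Helly selection gives a weak limit, whose moments come from
  \<open>binomial_power_moment_tendsto\<close> with \<open>j = 0\<close>.\<close>

theorem Hausdorff_moment_problem:
  fixes c :: "nat \<Rightarrow> real"
  assumes c0: "c 0 = 1" and pos: "\<And>l k. alternating_diff c l k \<ge> 0"
  shows "\<exists>P. real_distribution P \<and> (AE x in P. x \<in> {0..1}) \<and> (\<forall>n. (\<integral>x. x ^ n \<partial>P) = c n)"
proof -
  define w where "w N k = real (N choose k) * alternating_diff c (N - k) k" for N k
  have w: "w N k \<ge> 0" for N k using pos by (simp add: w_def)
  have sum_w: "(\<Sum>k\<le>N. w N k) = 1" for N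
    using sum_binomial_alternating_diff[of N c 0] c0 by (simp add: w_def)
  define A where "A N = point_measure {..N} (\<lambda>k. ennreal (w N k))" for N
  define \<mu> where "\<mu> N = distr (A N) borel (\<lambda>k. real k / real N)" for N
  have A_prob: "prob_space (A N)" for N
  proof (rule prob_spaceI)
    show "emeasure (A N) (space (A N)) = 1"
      unfolding A_def space_point_measure
      by (subst emeasure_point_measure_finite) (simp_all add: sum_ennreal w sum_w)
  qed
  have meas: "(\<lambda>k. real k / real N) \<in> borel_measurable (A N)" for N by (simp add: A_def)
  have dist: "real_distribution (\<mu> N)" for N
    unfolding \<mu>_def using prob_space.real_distribution_distr[OF A_prob meas] .
  have integ: "(\<integral>x. f x \<partial>\<mu> N) = (\<Sum>k\<le>N. w N k * f (real k / real N))"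
    if f: "f \<in> borel_measurable borel" for f :: "real \<Rightarrow> real" and N
    unfolding \<mu>_def integral_distr[OF meas f]
    unfolding A_def by (subst lebesgue_integral_point_measure_finite) (simp_all add: w)
  have "tight \<mu>"
    unfolding tight_def
  proof (intro conjI allI impI)
    fix \<epsilon> :: real assume \<epsilon>: "0 < \<epsilon>"
    have "measure (\<mu> N) {-1<..2} > 1 - \<epsilon>" for N
    proof -
      have "(\<lambda>k. real k / real N) -` {-1<..2} \<inter> space (A N) = space (A N)"
      proof -
        have "real k / real N \<in> {-1<..2}" if "k \<le> N" for k
        proof -
          have "real k / real N \<le> 1" "real k / real N \<ge> 0" using that by (auto simp: divide_le_eq_1)
          then show ?thesis unfolding greaterThanAtMost_iff by linarith
        qed
        then show ?thesis by (auto simp: A_def space_point_measure)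
      qed
      then have "measure (\<mu> N) {-1<..2} = 1"
        unfolding \<mu>_def by (subst measure_distr[OF meas]) (simp_all add: prob_space.prob_space[OF A_prob])
      then show ?thesis using \<epsilon> by simp
    qed
    then show "\<exists>a b::real. a < b \<and> (\<forall>n. 1 - \<epsilon> < measure (\<mu> n) {a<..b})"
      by (intro exI[of _ "-1"] exI[of _ 2]) simp
  qed (rule dist)
  then obtain s P where s: "strict_mono s" and P: "real_distribution P" and conv: "weak_conv_m (\<mu> \<circ> id \<circ> s) P"
    using tight_imp_convergent_subsubsequence[of \<mu> id] by (auto simp: strict_mono_id)
  interpret P: real_distribution P by fact
  \<comment> \<open>Weak convergence tests only bounded continuous functions, so powers are composed
    with the clamp onto [0,1], which fixes all grid points.\<close>
  define cl where "cl x = max 0 (min 1 x)" for x :: real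
  have cl_cont: "isCont cl x" for x unfolding cl_def by (intro continuous_intros)
  have cl01: "0 \<le> cl x" "cl x \<le> 1" for x by (auto simp: cl_def)
  have cl_grid: "cl (real k / real N) = real k / real N" if "k \<le> N" for k N
  proof -
    have "real k / real N \<le> 1" "real k / real N \<ge> 0" using that by (auto simp: divide_le_eq_1)
    then show ?thesis by (simp add: cl_def)
  qed
  have limP: "(\<lambda>n. \<integral>x. f x \<partial>\<mu> (s n)) \<longlonglongrightarrow> (\<integral>x. f x \<partial>P)"
    if "\<And>x. isCont f x" "\<And>x. norm (f x) \<le> 1" for f :: "real \<Rightarrow> real"
    using weak_conv_imp_integral_bdd_continuous_conv[of "\<mu> \<circ> id \<circ> s" P f 1] dist P conv that by (simp add: comp_def)
  have bm: "f \<in> borel_measurable borel" if "\<And>x. isCont f x" for f :: "real \<Rightarrow> real"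
    using that by (intro borel_measurable_continuous_onI continuous_at_imp_continuous_on) auto
  have moment: "(\<integral>x. cl x ^ n \<partial>P) = c n" for n
  proof -
    have cont: "isCont (\<lambda>x. cl x ^ n) x" for x by (intro continuous_intros cl_cont)
    have "(\<lambda>i. \<integral>x. cl x ^ n \<partial>\<mu> (s i)) \<longlonglongrightarrow> (\<integral>x. cl x ^ n \<partial>P)"
      by (rule limP[OF cont]) (simp add: cl01 power_le_one power_abs abs_of_nonneg)
    moreover have "(\<integral>x. cl x ^ n \<partial>\<mu> N) = (\<Sum>k\<le>N. real (N choose k) * alternating_diff c (N - k) k * real (k choose 0) * (real k / real N) ^ n)
      / real (N choose 0)" for N
      unfolding integ[OF bm[OF cont]] by (simp add: cl_grid w_def)
    then have "(\<lambda>N. \<integral>x. cl x ^ n \<partial>\<mu> N) \<longlonglongrightarrow> c n"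
      using binomial_power_moment_tendsto[of c 0 n] by simp
    then have "(\<lambda>i. \<integral>x. cl x ^ n \<partial>\<mu> (s i)) \<longlonglongrightarrow> c n"
      using LIMSEQ_subseq_LIMSEQ[OF _ s] by (fastforce simp: comp_def)
    ultimately show ?thesis by (rule LIMSEQ_unique)
  qed
  \<comment> \<open>A bounded continuous function vanishing exactly on [0,1]; its zero integral
    forces \<open>P\<close> to be supported there.\<close>
  define h where "h x = min 1 \<bar>x - cl x\<bar>" for x
  have h_cont: "isCont h x" for x unfolding h_def by (intro continuous_intros cl_cont)
  have "(\<lambda>i. \<integral>x. h x \<partial>\<mu> (s i)) \<longlonglongrightarrow> (\<integral>x. h x \<partial>P)"
    by (rule limP[OF h_cont]) (simp add: h_def)
  moreover have "(\<integral>x. h x \<partial>\<mu> N) = 0" for N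
    unfolding integ[OF bm[OF h_cont]] by (rule sum.neutral) (simp add: h_def cl_grid)
  ultimately have "(\<integral>x. h x \<partial>P) = 0" by (simp add: LIMSEQ_const_iff)
  moreover have "integrable P h"
  proof (rule P.integrable_const_bound[of _ 1])
    show "h \<in> borel_measurable P" using bm[OF h_cont] by simp
  qed (simp add: h_def)
  ultimately have "AE x in P. h x = 0"
    using integral_nonneg_eq_0_iff_AE[of P h] by (simp add: h_def[abs_def])
  then have AE_cl: "AE x in P. cl x = x"
    by eventually_elim (auto simp: h_def min_def split: if_splits)
  have "(\<integral>x. x ^ n \<partial>P) = c n" for n
  proof -
    have "(\<lambda>x. cl x ^ n) \<in> borel_measurable borel" by (rule bm) (intro continuous_intros cl_cont)
    then have "(\<integral>x. x ^ n \<partial>P) = (\<integral>x. cl x ^ n \<partial>P)"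
      using AE_cl by (intro integral_cong_AE) auto
    then show ?thesis by (simp add: moment)
  qed
  moreover have "AE x in P. x \<in> {0..1}"
    using AE_cl by eventually_elim (metis cl01 atLeastAtMost_iff)
  ultimately show ?thesis using P by blast
qed

section \<open>Positive definite kernels on the half-line\<close>

lemma moments_unique:
  fixes M N :: "real measure"
  assumes "finite_measure M" "finite_measure N"
    and sets: "sets M = sets borel" "sets N = sets borel"
    and "AE x in M. x \<in> {0..1}" "AE x in N. x \<in> {0..1}"
    and moments: "\<And>n. (\<integral>x. x ^ n \<partial>M) = (\<integral>x. x ^ n \<partial>N)"
  shows "M = N"
proof (rule measure_eqI)
  fix A assume "A \<in> sets M"
  then have "(\<Sum>b\<in>{False, True}. (if b then 1 else - 1) * measure (if b then M else N) A) = 0"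
    using assms by (intro signed_moments_zero) auto
  then show "emeasure M A = emeasure N A"
    using assms by (simp add: finite_measure.emeasure_eq_measure)
qed (simp add: sets)

text \<open>Sample points may be 0, unlike in \<open>positive_definite_halfline\<close>, so that
  differences starting at 0 are covered. Boundedness excludes increasing positive kernels such as
  \<open>exp\<close>.\<close>

definition halfline_kernel :: "(real \<Rightarrow> real) \<Rightarrow> bool" where
  "halfline_kernel f \<longleftrightarrow> bounded (f ` {0..}) \<and>
     (\<forall>(n::nat) s c. (\<forall>j<n. 0 \<le> s j) \<longrightarrow> 0 \<le> (\<Sum>j<n. \<Sum>k<n. c j * c k * f (s j + s k)))"

lemma halfline_kernel_sum_nonneg:
  assumes f: "halfline_kernel f" and I: "finite I" and s: "\<And>i. i \<in> I \<Longrightarrow> 0 \<le> s i"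
  shows "0 \<le> (\<Sum>i\<in>I. \<Sum>j\<in>I. c i * c j * f (s i + s j))"
proof -
  obtain h where h: "bij_betw h {..<card I} I"
    using ex_bij_betw_nat_finite[OF I] by (auto simp: atLeast0LessThan)
  have hI: "h j \<in> I" if "j < card I" for j using h that by (auto simp: bij_betw_def)
  have "0 \<le> (\<Sum>j<card I. \<Sum>k<card I. c (h j) * c (h k) * f (s (h j) + s (h k)))"
    using f[unfolded halfline_kernel_def, THEN conjunct2, rule_format, of "card I" "s \<circ> h" "c \<circ> h"] s hI by simp
  also have "\<dots> = (\<Sum>i\<in>I. \<Sum>j\<in>I. c i * c j * f (s i + s j))"
    unfolding sum.reindex_bij_betw[OF h, of "\<lambda>i. \<Sum>j\<in>I. c i * c j * f (s i + s j)", symmetric]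
    by (intro sum.cong refl sum.reindex_bij_betw[OF h])
  finally show ?thesis .
qed

lemma halfline_kernel_nonneg:
  assumes "halfline_kernel f" "0 \<le> t"
  shows "0 \<le> f t"
  using halfline_kernel_sum_nonneg[OF assms(1), of "{()}" "\<lambda>_. t / 2" "\<lambda>_. 1"] assms(2) by simp

text \<open>The increments of a convex sequence are nondecreasing, so a positive first increment
  would force at least linear growth.\<close>

lemma bounded_convex_sequence_decreasing:
  fixes g :: "nat \<Rightarrow> real"
  assumes convex: "\<And>m. 2 * g (Suc m) \<le> g m + g (Suc (Suc m))"
    and bounded: "\<And>m. g m \<le> K"
  shows "g 1 \<le> g 0"
proof (rule ccontr)
  define d where "d = g 1 - g 0"
  assume "\<not> g 1 \<le> g 0"
  then have d: "d > 0" by (simp add: d_def)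
  have inc: "d \<le> g (Suc m) - g m" for m
  proof (induction m)
    case (Suc m)
    then show ?case using convex[of m] by simp
  qed (simp add: d_def)
  have ge: "g 0 + real m * d \<le> g m" for m
  proof (induction m)
    case (Suc m)
    then show ?case using inc[of m] by (simp add: algebra_simps)
  qed simp
  obtain m where "K - g 0 < real m * d" using reals_Archimedean3[OF d] by blast
  then show False using ge[of m] bounded[of m] by simp
qed

text \<open>For fixed samples the quadratic form shifted by \<open>m * a\<close> is convex and
  bounded in \<open>m\<close>, hence drops in its first step; that drop is the quadratic form of the
  difference kernel.\<close>

lemma halfline_kernel_diff:
  assumes f: "halfline_kernel f" and a: "0 \<le> a"
  shows "halfline_kernel (\<lambda>t. f t - f (t + a))"
proof -
  obtain C where "\<forall>y\<in>f ` {0..}. norm y \<le> C"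
    using f unfolding halfline_kernel_def bounded_iff by blast
  then have C: "\<And>t. 0 \<le> t \<Longrightarrow> \<bar>f t\<bar> \<le> C" by simp
  have "bounded ((\<lambda>t. f t - f (t + a)) ` {0..})"
    unfolding bounded_iff
  proof (intro exI ballI)
    fix y assume "y \<in> (\<lambda>t. f t - f (t + a)) ` {0..}"
    then obtain t where "y = f t - f (t + a)" "0 \<le> t" by auto
    then show "norm y \<le> C + C" using C[of t] C[of "t + a"] a by simp
  qed
  moreover have "0 \<le> (\<Sum>j<n. \<Sum>k<n. c j * c k * (f (s j + s k) - f (s j + s k + a)))"
    if s: "\<forall>j<n. 0 \<le> s j" for n :: nat and s c
  proof -
    define g where "g m = (\<Sum>j<n. \<Sum>k<n. c j * c k * f (s j + s k + real m * a))" for m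
    have "2 * g (Suc m) \<le> g m + g (Suc (Suc m))" for m
    proof -
      let ?I = "{..<n} \<times> {False, True}"
      \<comment> \<open>Every sample is doubled: shift \<open>m * a / 2\<close> with weight
        \<open>c j\<close>, and shift \<open>(m + 2) * a / 2\<close> with weight
        \<open>- c j\<close>. Mixed terms land at \<open>Suc m\<close>, which produces a second
        difference.\<close>
      define s' where "s' p = s (fst p) + (if snd p then real (m + 2) * a / 2 else real m * a / 2)" for p
      define c' where "c' p = (if snd p then - c (fst p) else c (fst p))" for p
      have "0 \<le> (\<Sum>p\<in>?I. \<Sum>q\<in>?I. c' p * c' q * f (s' p + s' q))"
        by (rule halfline_kernel_sum_nonneg[OF f]) (use s a in \<open>auto simp: s'_def\<close>)
      also have "\<dots> = (\<Sum>j<n. \<Sum>b\<in>{False, True}. \<Sum>k<n. \<Sum>b'\<in>{False, True}. c' (j, b) * c' (k, b') * f (s' (j, b) + s' (k, b')))"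
      proof -
        have "(\<Sum>p\<in>?I. F p) = (\<Sum>j<n. \<Sum>b\<in>{False, True}. F (j, b))" for F :: "nat \<times> bool \<Rightarrow> real"
          by (simp only: sum.cartesian_product case_prod_eta)
        then show ?thesis by simp
      qed
      also have "\<dots> = (\<Sum>j<n. \<Sum>k<n. c j * c k * f (s j + s k + real m * a) + c j * c k * f (s j + s k + real (Suc (Suc m)) * a)
          - 2 * (c j * c k * f (s j + s k + real (Suc m) * a)))"
      proof (rule sum.cong[OF refl])
        fix j
        have e: "s' (j, False) + s' (k, False) = s j + s k + real m * a"
          "s' (j, True) + s' (k, False) = s j + s k + real (Suc m) * a"
          "s' (j, False) + s' (k, True) = s j + s k + real (Suc m) * a"
          "s' (j, True) + s' (k, True) = s j + s k + real (Suc (Suc m)) * a" for k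
          by (simp_all add: s'_def field_simps)
        have sb: "(\<Sum>b\<in>{False, True}. G b) = G False + G True" for G :: "bool \<Rightarrow> real" by simp
        have c': "c' (j, False) = c j" "c' (j, True) = - c j" for j by (simp_all add: c'_def)
        show "(\<Sum>b\<in>{False, True}. \<Sum>k<n. \<Sum>b'\<in>{False, True}. c' (j, b) * c' (k, b') * f (s' (j, b) + s' (k, b'))) =
          (\<Sum>k<n. c j * c k * f (s j + s k + real m * a) + c j * c k * f (s j + s k + real (Suc (Suc m)) * a)
            - 2 * (c j * c k * f (s j + s k + real (Suc m) * a)))"
          unfolding sb c' e sum.distrib[symmetric] by (intro sum.cong refl) (simp add: algebra_simps)
      qed
      also have "\<dots> = g m + g (Suc (Suc m)) - 2 * g (Suc m)"
        unfolding g_def by (simp only: sum.distrib sum_subtractf sum_distrib_left)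
      finally show ?thesis by simp
    qed
    moreover have "g m \<le> (\<Sum>j<n. \<Sum>k<n. \<bar>c j * c k\<bar> * C)" for m
      unfolding g_def
    proof (intro sum_mono)
      fix j k assume "j \<in> {..<n}" "k \<in> {..<n}"
      then have "\<bar>f (s j + s k + real m * a)\<bar> \<le> C" using s a by (intro C) simp
      then have "\<bar>c j * c k\<bar> * \<bar>f (s j + s k + real m * a)\<bar> \<le> \<bar>c j * c k\<bar> * C" by (intro mult_left_mono) auto
      then show "c j * c k * f (s j + s k + real m * a) \<le> \<bar>c j * c k\<bar> * C"
        by (metis abs_ge_self abs_mult order_trans)
    qed
    ultimately have "g 1 \<le> g 0" by (rule bounded_convex_sequence_decreasing)
    then show ?thesis unfolding g_def by (simp add: sum_subtractf right_diff_distrib)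
  qed
  ultimately show ?thesis unfolding halfline_kernel_def by blast
qed

text \<open>Each further difference replaces the kernel \<open>g\<close> by the kernel
  \<open>g t - g (t + h)\<close> sampled on the same grid, and kernels have nonnegative
  values.\<close>

lemma halfline_kernel_alternating_diff_nonneg:
  assumes "halfline_kernel f" "0 \<le> h"
  shows "0 \<le> alternating_diff (\<lambda>n. f (real n * h)) l k"
proof -
  have "\<exists>g. halfline_kernel g \<and> (\<forall>k. alternating_diff (\<lambda>n. f (real n * h)) l k = g (real k * h))"
  proof (induction l)
    case 0
    show ?case using assms by auto
  next
    case (Suc l)
    then obtain g where g: "halfline_kernel g" "\<And>k. alternating_diff (\<lambda>n. f (real n * h)) l k = g (real k * h)" by blast
    show ?case
      by (rule exI[of _ "\<lambda>t. g t - g (t + h)"])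
        (use halfline_kernel_diff[OF g(1) assms(2)] g(2) in \<open>simp add: algebra_simps\<close>)
  qed
  then show ?thesis using halfline_kernel_nonneg assms by (metis mult_nonneg_nonneg of_nat_0_le_iff)
qed

lemma halfline_kernelI:
  assumes cont: "continuous_on {0..} f" and bdd: "bounded (f ` {0..})"
    and pos: "\<And>(n::nat) s c. (\<And>j. j < n \<Longrightarrow> 0 < s j) \<Longrightarrow> 0 \<le> (\<Sum>j<n. \<Sum>k<n. c j * c k * f (s j + s k))"
  shows "halfline_kernel f"
  unfolding halfline_kernel_def
proof (intro conjI bdd allI impI)
  fix n :: nat and s c :: "nat \<Rightarrow> real"
  assume s: "\<forall>j<n. 0 \<le> s j"
  \<comment> \<open>Shifting all samples by \<open>e i\<close> moves them into the open half-line,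
    where \<open>pos\<close> applies; continuity lets the shift tend to 0.\<close>
  define e where "e i = 1 / real (Suc i)" for i
  have e: "e \<longlonglongrightarrow> 0" unfolding e_def by (rule LIMSEQ_Suc[OF lim_1_over_n])
  have e_pos: "e i > 0" for i by (simp add: e_def)
  have "(\<lambda>i. \<Sum>j<n. \<Sum>k<n. c j * c k * f ((s j + e i) + (s k + e i))) \<longlonglongrightarrow> (\<Sum>j<n. \<Sum>k<n. c j * c k * f (s j + s k))"
  proof (intro tendsto_sum tendsto_mult tendsto_const)
    fix j k assume jk: "j \<in> {..<n}" "k \<in> {..<n}"
    have "(\<lambda>i. (s j + e i) + (s k + e i)) \<longlonglongrightarrow> (s j + 0) + (s k + 0)" by (intro tendsto_intros e)
    then show "(\<lambda>i. f ((s j + e i) + (s k + e i))) \<longlonglongrightarrow> f (s j + s k)"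
    proof (intro continuous_on_tendsto_compose[OF cont])
      have "0 \<le> s j + e i + (s k + e i)" for i
        using s jk less_imp_le[OF e_pos[of i]] by (intro add_nonneg_nonneg) auto
      then show "\<forall>\<^sub>F i in sequentially. s j + e i + (s k + e i) \<in> {0..}" by simp
    qed (use s jk in auto)
  qed
  then show "0 \<le> (\<Sum>j<n. \<Sum>k<n. c j * c k * f (s j + s k))"
  proof (rule LIMSEQ_le_const, intro exI[of _ 0] allI impI)
    fix i
    show "0 \<le> (\<Sum>j<n. \<Sum>k<n. c j * c k * f (s j + e i + (s k + e i)))"
      by (rule pos) (use s e_pos in \<open>simp add: add_nonneg_pos\<close>)
  qed
qed


section \<open>Integral representation of half-line kernels\<close>

lemma tendsto_powr_exponent:
  fixes x :: real
  assumes "r \<longlonglongrightarrow> t"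
  shows "(\<lambda>n. x powr r n) \<longlonglongrightarrow> x powr t"
  using assms by (cases "x = 0") (auto intro: tendsto_powr)

theorem halfline_kernel_representation:
  assumes f: "halfline_kernel f" and cont: "continuous_on {0..} f"
  shows "\<exists>P. finite_measure P \<and> sets P = sets borel \<and> (AE x in P. x \<in> {0<..1}) \<and>
    (\<forall>t\<ge>0. (\<integral>x. x powr t \<partial>P) = f t)"
proof (cases "f 0 = 0")
  case True
  \<comment> \<open>No normalization by \<open>f 0\<close> is possible here, but \<open>f t\<close>
    and \<open>f 0 - f t\<close> are both nonnegative, so the zero measure serves.\<close>
  have "f t = 0" if "t \<ge> 0" for t
    using halfline_kernel_nonneg[OF f that] halfline_kernel_nonneg[OF halfline_kernel_diff[OF f that], of 0] True by simp
  moreover have "(\<integral>x. x powr t \<partial>null_measure borel) = 0" for t :: real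
    by (rule integral_eq_zero_AE) (simp add: AE_iff_null null_sets_def)
  moreover have "AE x in null_measure (borel :: real measure). x \<in> {0<..1}"
    by (simp add: AE_iff_null null_sets_def)
  ultimately show ?thesis
    by (intro exI[of _ "null_measure borel"]) (auto intro: finite_measureI)
next
  case False
  then have f0: "f 0 > 0" using halfline_kernel_nonneg[OF f, of 0] by simp
  \<comment> \<open>\<open>q = 0\<close> is included: division by zero then makes every moment
    1.\<close>
  have "\<exists>P. real_distribution P \<and> (AE x in P. x \<in> {0..1}) \<and> (\<forall>n. (\<integral>x. x ^ n \<partial>P) = f (real n / real q) / f 0)" for q
  proof (rule Hausdorff_moment_problem)
    show "f (real 0 / real q) / f 0 = 1" using f0 by simp
    have "halfline_kernel (\<lambda>t. f t / f 0)"
      unfolding halfline_kernel_def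
    proof (intro conjI allI impI)
      have "bounded (f ` {0..})" using f by (simp add: halfline_kernel_def)
      then have "bounded ((\<lambda>y. y /\<^sub>R f 0) ` f ` {0..})" by (rule bounded_scaling)
      then show "bounded ((\<lambda>t. f t / f 0) ` {0..})" by (simp add: image_image divide_inverse mult.commute)
    next
      fix n :: nat and s c :: "nat \<Rightarrow> real" assume s: "\<forall>j<n. 0 \<le> s j"
      have "0 \<le> (\<Sum>j<n. \<Sum>k<n. c j * c k * f (s j + s k)) / f 0"
        using f s f0 by (simp add: halfline_kernel_def)
      then show "0 \<le> (\<Sum>j<n. \<Sum>k<n. c j * c k * (f (s j + s k) / f 0))"
        by (simp add: sum_divide_distrib)
    qed
    from halfline_kernel_alternating_diff_nonneg[OF this, of "1 / real q"]
    show "0 \<le> alternating_diff (\<lambda>n. f (real n / real q) / f 0) l k" for l k by simp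
  qed
  then obtain P where dist: "\<And>q. real_distribution (P q)"
    and supp: "\<And>q. AE x in P q. x \<in> {0..1}"
    and mom: "\<And>q n. (\<integral>x. x ^ n \<partial>P q) = f (real n / real q) / f 0"
    by metis
  define R where "R = P 1"
  interpret R: real_distribution R using dist by (simp add: R_def)
  \<comment> \<open>The \<open>n\<close>-th moment of the image is the \<open>q * n\<close>-th
    moment of \<open>P q\<close>, that is \<open>f n / f 0\<close>, whatever \<open>q\<close>
    is.\<close>
  have push: "distr (P q) borel (\<lambda>x. x ^ q) = R" if q: "q > 0" for q
  proof -
    interpret Pq: real_distribution "P q" by (rule dist)
    have m: "(\<lambda>x. x ^ q) \<in> borel_measurable (P q)" by simp
    have "prob_space (distr (P q) borel (\<lambda>x. x ^ q))" by (rule Pq.prob_space_distr[OF m])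
    then have "finite_measure (distr (P q) borel (\<lambda>x. x ^ q))" by (simp add: prob_space_def)
    then show ?thesis
    proof (rule moments_unique)
      show "AE x in distr (P q) borel (\<lambda>x. x ^ q). x \<in> {0..1}"
        using supp[of q] by (subst AE_distr_iff[OF m]) (auto simp: power_le_one elim: eventually_mono)
      show "(\<integral>x. x ^ n \<partial>distr (P q) borel (\<lambda>x. x ^ q)) = (\<integral>x. x ^ n \<partial>R)" for n
      proof -
        have "(\<integral>x. x ^ n \<partial>distr (P q) borel (\<lambda>x. x ^ q)) = (\<integral>x. x ^ (q * n) \<partial>P q)"
          by (subst integral_distr[OF m]) (simp_all add: power_mult)
        also have "\<dots> = f (real n / real 1) / f 0" using q by (simp add: mom)
        finally show ?thesis by (simp add: R_def mom)
      qed
    next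
      show "finite_measure R" by (rule R.finite_measure_axioms)
      show "AE x in R. x \<in> {0..1}" by (rule supp[of 1, folded R_def])
    qed simp_all
  qed
  have rat: "(\<integral>x. x powr r \<partial>R) = f r / f 0" if r: "r \<in> \<rat>" "r > 0" for r
  proof -
    obtain p q :: nat where q: "q \<noteq> 0" and r_eq: "r = real p / real q"
      using Rats_abs_nat_div_natE[OF r(1)] r(2) by (metis abs_of_pos)
    \<comment> \<open>This settles the point 0, where \<open>0 powr r\<close> and
      \<open>0 ^ p\<close> must agree; \<open>0 ^ 0\<close> would be 1.\<close>
    have p: "p > 0" using r(2) r_eq by (cases p) auto
    interpret Pq: real_distribution "P q" by (rule dist)
    have "(\<integral>x. x powr r \<partial>R) = (\<integral>x. x powr r \<partial>distr (P q) borel (\<lambda>x. x ^ q))"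
      using push q by simp
    also have "\<dots> = (\<integral>x. (x ^ q) powr r \<partial>P q)"
      by (subst integral_distr) simp_all
    also have "\<dots> = (\<integral>x. x ^ p \<partial>P q)"
    proof (rule integral_cong_AE)
      show "AE x in P q. (x ^ q) powr r = x ^ p"
        using supp[of q]
      proof eventually_elim
        fix x :: real assume x: "x \<in> {0..1}"
        show "(x ^ q) powr r = x ^ p"
        proof (cases "x = 0")
          case False
          then have "(x ^ q) powr r = x powr (real q * r)" using x by (simp add: powr_powr flip: powr_realpow)
          also have "real q * r = real p" using q r_eq by simp
          finally show ?thesis using False x by (simp add: powr_realpow)
        qed (use p q in \<open>simp add: zero_power\<close>)
      qed
    qed simp_all
    finally show ?thesis by (simp add: mom r_eq)
  qed
  have all: "(\<integral>x. x powr t \<partial>R) = f t / f 0" if t: "t \<ge> 0" for t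
  proof -
    \<comment> \<open>Rationals strictly above \<open>t\<close> stay positive even for
      \<open>t = 0\<close>, as \<open>rat\<close> requires.\<close>
    have "\<exists>r\<in>\<rat>. t < r \<and> r < t + 1 / real (Suc n)" for n by (rule Rats_dense_in_real) simp
    then obtain r where r: "\<And>n. r n \<in> \<rat>" "\<And>n. t < r n" "\<And>n. r n < t + 1 / real (Suc n)" by metis
    have r_lim: "r \<longlonglongrightarrow> t"
    proof (rule tendsto_sandwich[of "\<lambda>_. t" _ _ "\<lambda>n. t + 1 / real (Suc n)"])
      have "(\<lambda>n. t + 1 / real (Suc n)) \<longlonglongrightarrow> t + 0"
        by (intro tendsto_intros LIMSEQ_Suc[OF lim_1_over_n])
      then show "(\<lambda>n. t + 1 / real (Suc n)) \<longlonglongrightarrow> t" by simp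
    qed (use less_imp_le[OF r(2)] less_imp_le[OF r(3)] in simp_all)
    have "(\<lambda>n. \<integral>x. x powr r n \<partial>R) \<longlonglongrightarrow> (\<integral>x. x powr t \<partial>R)"
    proof (rule integral_dominated_convergence[where w="\<lambda>_. 1"])
      show "AE x in R. norm (x powr r n) \<le> 1" for n
        using supp[of 1, folded R_def]
        by eventually_elim (use t r(2)[of n] in \<open>auto intro!: powr_le1\<close>)
      show "AE x in R. (\<lambda>n. x powr r n) \<longlonglongrightarrow> x powr t"
        by (rule AE_I2) (rule tendsto_powr_exponent[OF r_lim])
    qed simp_all
    moreover have "(\<integral>x. x powr r n \<partial>R) = f (r n) / f 0" for n
      using r t by (intro rat) (auto intro: le_less_trans)
    moreover have "(\<lambda>n. f (r n) / f 0) \<longlonglongrightarrow> f t / f 0"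
    proof (intro tendsto_divide tendsto_const continuous_on_tendsto_compose[OF cont r_lim])
      have "r n \<ge> 0" for n using r(2)[of n] t by simp
      then show "\<forall>\<^sub>F n in sequentially. r n \<in> {0..}" by simp
    qed (use t f0 in auto)
    ultimately show ?thesis using LIMSEQ_unique by simp
  qed
  \<comment> \<open>Since \<open>0 powr 0 = 0\<close>, the case \<open>t = 0\<close> of
    \<open>all\<close> measures the complement of 0; continuity of \<open>f\<close> at 0 thus
    excludes an atom there.\<close>
  have "R.prob {x. x \<noteq> 0} = (\<integral>x. indicator {x. x \<noteq> 0} x \<partial>R)" by simp
  also have "\<dots> = (\<integral>x. x powr 0 \<partial>R)"
    by (intro Bochner_Integration.integral_cong) (auto simp: indicator_def)
  also have "\<dots> = 1" using all[of 0] f0 by simp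
  finally have "AE x in R. x \<in> {x. x \<noteq> 0}" by (rule R.AE_prob_1)
  then have R_supp: "AE x in R. x \<in> {0<..1}"
    using supp[of 1, folded R_def] by eventually_elim auto
  define Q where "Q = density R (\<lambda>_. ennreal (f 0))"
  have "finite_measure Q"
    by (rule finite_measureI) (simp add: Q_def emeasure_density R.emeasure_eq_measure ennreal_mult_eq_top_iff)
  moreover have "sets Q = sets borel" by (simp add: Q_def)
  moreover have "AE x in Q. x \<in> {0<..1}"
    unfolding Q_def by (subst AE_density) (use R_supp in \<open>auto elim: eventually_mono\<close>)
  moreover have "(\<integral>x. x powr t \<partial>Q) = f t" if "t \<ge> 0" for t
    unfolding Q_def by (subst integral_density) (use f0 all[OF that] in auto)
  ultimately show ?thesis by blast
qed

section \<open>Operator-valued Laplace transforms\<close>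

lemma Re_nonneg_Reals: "z \<in> \<real>\<^sub>\<ge>\<^sub>0 \<Longrightarrow> 0 \<le> Re z \<and> of_real (Re z) = z"
  by (auto elim!: nonneg_Reals_cases)

text \<open>With all vectors proportional to one \<open>v\<close>, operator positivity becomes
  positivity of a scalar kernel; diagonal values at \<open>0 \<le> t\<close> are real, so the real
  inner product captures them.\<close>

lemma reflection_positive_diagonal:
  fixes \<phi> :: "real \<Rightarrow> 'f::complex_hilbert_space \<Rightarrow> 'f"
  assumes lin: "\<And>x. bounded_clinear (\<phi> x)" and sc: "strongly_continuous \<phi>" and rp: "reflection_positive \<phi>"
  shows "0 \<le> t \<Longrightarrow> of_real (inner (\<phi> t v) v) = cinner (\<phi> t v) v" (is "_ \<Longrightarrow> ?real")
    and "halfline_kernel (\<lambda>t. inner (\<phi> t v) v)" (is ?kernel)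
    and "continuous_on {0..} (\<lambda>t. inner (\<phi> t v) v)" (is ?cont)
proof -
  have pd: "positive_definite \<phi>" and even: "\<And>x. \<phi> (- x) = \<phi> x" and half: "positive_definite_halfline \<phi>"
    using rp by (auto simp: reflection_positive_def)
  have nonneg: "cinner (\<phi> t v) v \<in> \<real>\<^sub>\<ge>\<^sub>0" if "0 \<le> t" for t
  proof (cases "t = 0")
    case True
    then show ?thesis
      using pd[unfolded positive_definite_def, rule_format, where n=1 and x="\<lambda>_. 0" and v="\<lambda>_. v"] by simp
  next
    case False
    then show ?thesis
      using half[unfolded positive_definite_halfline_def, rule_format, where n=1 and s="\<lambda>_. t / 2" and v="\<lambda>_. v"] that by simp
  qed
  show "0 \<le> t \<Longrightarrow> ?real"
    using Re_nonneg_Reals[OF nonneg[of t]] by (simp add: inner_eq_Re_cinner)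
  have linear: "linear (\<phi> x)" for x using lin by (auto simp: bounded_clinear_def bounded_linear.linear)
  \<comment> \<open>The points \<open>t\<close> and 0 with vectors \<open>v\<close> and
    \<open>- v\<close> give twice the difference of the two sides, evenness merging the cross terms.
    This is the bound the kernel needs.\<close>
  have le0: "inner (\<phi> t v) v \<le> inner (\<phi> 0 v) v" for t
  proof -
    have "(\<Sum>j<(2::nat). \<Sum>k<(2::nat). cinner (\<phi> ((if j = 0 then t else 0) - (if k = 0 then t else 0))
        (if k = 0 then v else - v)) (if j = 0 then v else - v)) \<in> \<real>\<^sub>\<ge>\<^sub>0"
      by (rule pd[unfolded positive_definite_def, rule_format, where n=2
            and x="\<lambda>j. if j = 0 then t else 0" and v="\<lambda>j. if j = 0 then v else - v"])
    then have "0 \<le> (\<Sum>j<(2::nat). \<Sum>k<(2::nat). inner (\<phi> ((if j = 0 then t else 0) - (if k = 0 then t else 0))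
        (if k = 0 then v else - v)) (if j = 0 then v else - v))"
      unfolding inner_eq_Re_cinner Re_sum[symmetric] using Re_nonneg_Reals by blast
    then show ?thesis by (simp add: numeral_2_eq_2 even linear_neg[OF linear])
  qed
  show ?cont
  proof -
    have "continuous_on UNIV (\<lambda>x. \<phi> x v)" using sc by (simp add: strongly_continuous_def)
    then have "continuous_on {0..} (\<lambda>x. \<phi> x v)" by (rule continuous_on_subset) simp
    then show ?thesis by (intro continuous_intros)
  qed
  then show ?kernel
  proof (rule halfline_kernelI)
    show "bounded ((\<lambda>t. inner (\<phi> t v) v) ` {0..})"
      unfolding bounded_iff
    proof (intro exI ballI)
      fix y assume "y \<in> (\<lambda>t. inner (\<phi> t v) v) ` {0..}"
      then obtain t where "0 \<le> t" "y = inner (\<phi> t v) v" by auto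
      then show "norm y \<le> inner (\<phi> 0 v) v"
        using le0[of t] conjunct1[OF Re_nonneg_Reals[OF nonneg[of t]]] by (simp add: inner_eq_Re_cinner)
    qed
    fix n :: nat and s c :: "nat \<Rightarrow> real"
    assume s: "\<And>j. j < n \<Longrightarrow> 0 < s j"
    have "(\<Sum>j<n. \<Sum>k<n. cinner (\<phi> (s j + s k) (c k *\<^sub>R v)) (c j *\<^sub>R v)) \<in> \<real>\<^sub>\<ge>\<^sub>0"
      by (rule half[unfolded positive_definite_halfline_def, rule_format, where s=s and v="\<lambda>k. c k *\<^sub>R v"])
        (rule s)
    then have "0 \<le> Re (\<Sum>j<n. \<Sum>k<n. cinner (\<phi> (s j + s k) (c k *\<^sub>R v)) (c j *\<^sub>R v))"
      using Re_nonneg_Reals by blast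
    also have "\<dots> = (\<Sum>j<n. \<Sum>k<n. c j * c k * inner (\<phi> (s j + s k) v) v)"
      unfolding Re_sum inner_eq_Re_cinner[symmetric] by (simp add: linear_cmul[OF linear] mult.assoc)
    finally show "0 \<le> (\<Sum>j<n. \<Sum>k<n. c j * c k * inner (\<phi> (s j + s k) v) v)" .
  qed
qed

theorem reflection_positive_imp_laplace_transform:
  fixes \<phi> :: "real \<Rightarrow> 'f::complex_hilbert_space \<Rightarrow> 'f"
  assumes lin: "\<And>x. bounded_clinear (\<phi> x)" and sc: "strongly_continuous \<phi>" and rp: "reflection_positive \<phi>"
  shows "\<exists>Q :: real set \<Rightarrow> 'f \<Rightarrow> 'f.
       herm_pos_measure (restrict_space borel {0..}) Q \<and>
       (\<forall>x. has_weak_integral (restrict_space borel {0..}) Q (\<lambda>l. exp (- l * \<bar>x\<bar>)) (\<phi> x))"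
proof -
  define f where "f v t = inner (\<phi> t v) v" for v t
  note diag = reflection_positive_diagonal[OF lin sc rp, folded f_def]
  have "\<exists>P. finite_measure P \<and> sets P = sets borel \<and> (AE x in P. x \<in> {0<..1}) \<and>
    (\<forall>t\<ge>0. (\<integral>x. x powr t \<partial>P) = f v t)" for v
    using halfline_kernel_representation[OF diag(2,3)] .
  then obtain P where fin: "\<And>v. finite_measure (P v)" and sets: "\<And>v. sets (P v) = sets borel"
    and supp: "\<And>v. AE x in P v. x \<in> {0<..1}"
    and powr: "\<And>v t. 0 \<le> t \<Longrightarrow> (\<integral>x. x powr t \<partial>P v) = f v t"
    by metis
  have space: "space (P v) = UNIV" for v using sets_eq_imp_space_eq[OF sets] by simp
  have meas: "g \<in> measurable (P v) N \<longleftrightarrow> g \<in> measurable borel N" for g v and N :: "'b measure"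
    by (rule arg_cong[where f="\<lambda>X. g \<in> X"], rule measurable_cong_sets[OF sets refl])
  have moment: "(\<integral>x. x ^ n \<partial>P v) = f v (real n)" for n v
  proof -
    have "(\<integral>x. x ^ n \<partial>P v) = (\<integral>x. x powr real n \<partial>P v)"
    proof (rule integral_cong_AE)
      show "AE x in P v. x ^ n = x powr real n"
        using supp[of v] by eventually_elim (simp add: powr_realpow)
    qed (simp_all add: meas)
    then show ?thesis by (simp add: powr)
  qed
  define M where "M = (restrict_space borel {0..} :: real measure)"
  have spM: "space M = {0..}" by (simp add: M_def space_restrict_space)
  \<comment> \<open>The maximum with 0 changes nothing on \<open>{0<..1}\<close> and makes
    \<open>\<kappa>\<close> a map of the whole line into the space of \<open>M\<close>.\<close>
  define \<kappa> where "\<kappa> x = max 0 (- ln x)" for x :: real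
  have \<kappa>: "\<kappa> \<in> measurable (P v) M" for v
    unfolding meas M_def
  proof (rule measurable_restrict_space2)
    show "\<kappa> \<in> borel_measurable borel" unfolding \<kappa>_def by measurable
  qed (auto simp: \<kappa>_def)
  define \<mu> where "\<mu> v = distr (P v) M \<kappa>" for v
  have sets_\<mu>: "sets (\<mu> v) = sets M" and space_\<mu>: "space (\<mu> v) = space M" for v by (simp_all add: \<mu>_def)
  have fin_\<mu>: "finite_measure (\<mu> v)" for v
    unfolding \<mu>_def by (rule finite_measure.finite_measure_distr[OF fin \<kappa>])
  have borel_exp: "(\<lambda>l. exp (- l * t)) \<in> borel_measurable M" for t
    unfolding M_def by (intro measurable_restrict_space1) measurable
  have laplace: "(\<integral>l. exp (- l * t) \<partial>\<mu> v) = f v t" if t: "0 \<le> t" for t v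
  proof -
    have "(\<integral>l. exp (- l * t) \<partial>\<mu> v) = (\<integral>x. exp (- \<kappa> x * t) \<partial>P v)"
      unfolding \<mu>_def by (rule integral_distr[OF \<kappa> borel_exp])
    also have "\<dots> = (\<integral>x. x powr t \<partial>P v)"
    proof (rule integral_cong_AE)
      show "(\<lambda>x. exp (- \<kappa> x * t)) \<in> borel_measurable (P v)" by (rule measurable_compose[OF \<kappa> borel_exp])
      show "(\<lambda>x. x powr t) \<in> borel_measurable (P v)" by (simp add: meas)
      show "AE x in P v. exp (- \<kappa> x * t) = x powr t"
        using supp[of v] by eventually_elim (simp add: \<kappa>_def powr_def max_def mult.commute)
    qed
    finally show ?thesis using powr[OF t] by simp
  qed
  define q where "q E v = measure (\<mu> v) E" for E v
  \<comment> \<open>Linear relations among the functions \<open>f u\<close> hold for the moments of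
    the \<open>P u\<close>, hence for the masses \<open>q E u\<close>. Lists of pairs allow vectors
    to coincide.\<close>
  have transfer: "(\<Sum>(a, u)\<leftarrow>xs. a * q E u) = 0"
    if E: "E \<in> sets M" and xs: "\<And>t. (\<Sum>(a, u)\<leftarrow>xs. a * f u t) = 0" for E and xs :: "(real \<times> 'f) list"
  proof -
    have nth: "(\<Sum>(a, u)\<leftarrow>xs. a * h u) = (\<Sum>i<length xs. fst (xs ! i) * h (snd (xs ! i)))" for h :: "'f \<Rightarrow> real"
      by (subst sum_list_sum_nth) (simp add: atLeast0LessThan split_beta)
    have "(\<Sum>i<length xs. fst (xs ! i) * measure (P (snd (xs ! i))) (\<kappa> -` E \<inter> UNIV)) = 0"
    proof (rule signed_moments_zero)
      show "(\<Sum>i<length xs. fst (xs ! i) * (\<integral>x. x ^ n \<partial>P (snd (xs ! i)))) = 0" for n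
        using xs[of "real n"] by (simp add: moment nth)
      show "AE x in P (snd (xs ! i)). x \<in> {0..1}" for i
        using supp[of "snd (xs ! i)"] by eventually_elim simp
      show "\<kappa> -` E \<inter> UNIV \<in> sets borel"
        using measurable_sets[OF \<kappa>[of 0] E] by (simp add: sets space)
    qed (auto simp: fin sets)
    then show ?thesis unfolding nth q_def \<mu>_def by (simp add: measure_distr[OF \<kappa> E] space)
  qed
  have add\<phi>: "\<phi> t (u + v) = \<phi> t u + \<phi> t v" and scale\<phi>: "\<phi> t (r *\<^sub>R v) = r *\<^sub>R \<phi> t v"
    and scaleC\<phi>: "\<phi> t (a *\<^sub>C v) = a *\<^sub>C \<phi> t v" for t u v r a
    using lin[of t] by (auto simp: bounded_clinear_def linear_add linear_cmul bounded_linear.linear)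
  obtain K where K: "\<And>v. norm (\<phi> 0 v) \<le> norm v * K"
    using lin[of 0] bounded_linear.bounded unfolding bounded_clinear_def by blast
  have "\<exists>T. T \<in> herm_pos \<and> (\<forall>v. cinner (T v) v = of_real (q E v))" if E: "E \<in> sets M" for E
  \<comment> \<open>\<open>K\<close> works for every \<open>E\<close> because the total mass of
    \<open>\<mu> v\<close> is \<open>f v 0\<close>; the identities are instances of
    \<open>transfer\<close> with all terms moved to one side.\<close>
  proof (rule herm_pos_of_quadratic_form[where C=K])
    show "0 \<le> q E v" for v by (simp add: q_def)
    show "q E v \<le> K * (norm v)\<^sup>2" for v
    proof -
      have "q E v \<le> measure (\<mu> v) (space (\<mu> v))"
        unfolding q_def by (rule finite_measure.bounded_measure[OF fin_\<mu>])
      also have "\<dots> = f v 0" using laplace[of 0 v] by simp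
      also have "\<dots> \<le> norm (\<phi> 0 v) * norm v" unfolding f_def by (rule norm_cauchy_schwarz)
      also have "\<dots> \<le> (norm v * K) * norm v" by (intro mult_right_mono K) simp
      finally show ?thesis by (simp add: power2_eq_square mult.commute mult.left_commute)
    qed
    show "q E (\<i> *\<^sub>C v) = q E v" for v
      using transfer[OF E, of "[(1, \<i> *\<^sub>C v), (-1, v)]"] by (simp add: f_def scaleC\<phi> inner_ii_ii)
    show "q E (r *\<^sub>R v) = r\<^sup>2 * q E v" for r v
      using transfer[OF E, of "[(1, r *\<^sub>R v), (- (r\<^sup>2), v)]"] by (simp add: f_def scale\<phi> power2_eq_square)
    show "q E (u + v + w) + q E u + q E v + q E w = q E (u + v) + q E (v + w) + q E (u + w)" for u v w
      using transfer[OF E, of "[(1, u + v + w), (1, u), (1, v), (1, w), (-1, u + v), (-1, v + w), (-1, u + w)]"]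
      by (simp add: f_def add\<phi> inner_add_left inner_add_right)
    show "q E (u + r *\<^sub>R v) + r * q E u + r * q E v = q E u + r\<^sup>2 * q E v + r * q E (u + v)" for r u v
      using transfer[OF E, of "[(1, u + r *\<^sub>R v), (r, u), (r, v), (-1, u), (- (r\<^sup>2), v), (- r, u + v)]"]
      by (simp add: f_def add\<phi> scale\<phi> inner_add_left inner_add_right power2_eq_square algebra_simps)
  qed
  then obtain Q where Q: "\<And>E. E \<in> sets M \<Longrightarrow> Q E \<in> herm_pos"
    and Qq: "\<And>E v. E \<in> sets M \<Longrightarrow> cinner (Q E v) v = of_real (q E v)"
    by metis
  have em: "ennreal (Re (cinner (Q E v) v)) = emeasure (\<mu> v) E" if "E \<in> sets M" for E v
    using that by (simp add: Qq q_def finite_measure.emeasure_eq_measure[OF fin_\<mu>])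
  have "measure_space (space M) (sets M) (\<lambda>E. ennreal (Re (cinner (Q E v) v)))" for v
    using measure_space[of "\<mu> v"] measure_space_eq[of "sets M" "space M" "\<lambda>E. ennreal (Re (cinner (Q E v) v))" "emeasure (\<mu> v)"]
    by (simp add: em space_\<mu> sets_\<mu> sets.sigma_sets_eq sets.space_closed)
  then have "herm_pos_measure M Q" unfolding herm_pos_measure_def using Q by blast
  moreover have "has_weak_integral M Q (\<lambda>l. exp (- l * \<bar>x\<bar>)) (\<phi> x)" for x
    unfolding has_weak_integral_def
  proof (intro conjI allI lin)
    fix v
    have "scalar_measure M Q v = measure_of (space (\<mu> v)) (sets (\<mu> v)) (emeasure (\<mu> v))"
      unfolding scalar_measure_def space_\<mu> sets_\<mu>
      by (rule measure_of_eq) (simp_all add: em sets.sigma_sets_eq sets.space_closed)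
    then have sm: "scalar_measure M Q v = \<mu> v" by (simp add: measure_of_of_measure)
    interpret finite_measure "\<mu> v" by (rule fin_\<mu>)
    show "integrable (scalar_measure M Q v) (\<lambda>l. exp (- l * \<bar>x\<bar>))"
      unfolding sm
    proof (rule integrable_const_bound[of _ 1])
      show "AE l in \<mu> v. norm (exp (- l * \<bar>x\<bar>)) \<le> 1" by (rule AE_I2) (simp add: space_\<mu> spM)
      show "(\<lambda>l. exp (- l * \<bar>x\<bar>)) \<in> borel_measurable (\<mu> v)"
        unfolding measurable_cong_sets[OF sets_\<mu> refl] by (rule borel_exp)
    qed
    have "\<phi> x = \<phi> \<bar>x\<bar>" using rp by (auto simp: reflection_positive_def abs_if)
    then have "cinner (\<phi> x v) v = of_real (f v \<bar>x\<bar>)" using diag(1)[of "\<bar>x\<bar>" v] by simp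
    then show "cinner (\<phi> x v) v = of_real (\<integral>l. exp (- l * \<bar>x\<bar>) \<partial>scalar_measure M Q v)"
      unfolding sm laplace[OF abs_ge_zero] .
  qed
  ultimately show ?thesis unfolding M_def by blast
qed

section \<open>From an operator-valued measure to half-line positivity\<close>

lemma scalar_measure:
  assumes "herm_pos_measure M Q"
  shows space_scalar_measure: "space (scalar_measure M Q v) = space M"
    and sets_scalar_measure: "sets (scalar_measure M Q v) = sets M"
    and measure_scalar_measure: "E \<in> sets M \<Longrightarrow> of_real (measure (scalar_measure M Q v) E) = cinner (Q E v) v"
    and finite_scalar_measure: "finite_measure (scalar_measure M Q v)"
proof -
  show sp: "space (scalar_measure M Q v) = space M"
    by (simp add: scalar_measure_def space_measure_of sets.space_closed)
  show "sets (scalar_measure M Q v) = sets M"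
    by (simp add: scalar_measure_def sets_measure_of sets.space_closed sets.sigma_sets_eq)
  have em: "emeasure (scalar_measure M Q v) E = ennreal (Re (cinner (Q E v) v))" if "E \<in> sets M" for E
    unfolding scalar_measure_def using assms that
    by (intro emeasure_measure_of_sigma) (auto simp: herm_pos_measure_def measure_space_def)
  show "of_real (measure (scalar_measure M Q v) E) = cinner (Q E v) v" if "E \<in> sets M"
  proof -
    have "Q E \<in> herm_pos" using assms that by (simp add: herm_pos_measure_def)
    then have "cinner (Q E v) v \<in> \<real>\<^sub>\<ge>\<^sub>0" unfolding herm_pos_def by blast
    then show ?thesis by (auto simp: measure_def em that elim!: nonneg_Reals_cases)
  qed
  show "finite_measure (scalar_measure M Q v)"
    by (rule finite_measureI) (simp add: sp em)
qed

lemma sum_in_nonneg_Reals: "(\<And>i. i \<in> I \<Longrightarrow> f i \<in> \<real>\<^sub>\<ge>\<^sub>0) \<Longrightarrow> sum f I \<in> \<real>\<^sub>\<ge>\<^sub>0"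
  by (induction I rule: infinite_finite_induct) (auto intro: nonneg_Reals_add_I)

text \<open>A product weight moves into the vectors: each \<open>i\<close> contributes
  \<open>cinner (T i w) w\<close> with \<open>w = (\<Sum>k<n. e k i *\<^sub>R v k)\<close>.\<close>

lemma herm_pos_sum_nonneg:
  fixes v :: "nat \<Rightarrow> 'f::complex_hilbert_space" and e :: "nat \<Rightarrow> 'i \<Rightarrow> real"
  assumes T: "\<And>i. i \<in> I \<Longrightarrow> T i \<in> herm_pos"
  shows "(\<Sum>j<n. \<Sum>k<n. \<Sum>i\<in>I. of_real (e j i * e k i) * cinner (T i (v k)) (v j)) \<in> \<real>\<^sub>\<ge>\<^sub>0"
proof -
  have "(\<Sum>j<n. \<Sum>k<n. \<Sum>i\<in>I. of_real (e j i * e k i) * cinner (T i (v k)) (v j)) =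
      (\<Sum>j<n. \<Sum>i\<in>I. \<Sum>k<n. of_real (e j i * e k i) * cinner (T i (v k)) (v j))"
    by (intro sum.cong refl sum.swap)
  also have "\<dots> = (\<Sum>i\<in>I. \<Sum>j<n. \<Sum>k<n. of_real (e j i * e k i) * cinner (T i (v k)) (v j))"
    by (rule sum.swap)
  also have "\<dots> = (\<Sum>i\<in>I. cinner (T i (\<Sum>k<n. e k i *\<^sub>R v k)) (\<Sum>j<n. e j i *\<^sub>R v j))"
  proof (rule sum.cong[OF refl])
    fix i assume "i \<in> I"
    then have "linear (T i)" using T by (auto simp: herm_pos_def bounded_clinear_def bounded_linear.linear)
    then show "(\<Sum>j<n. \<Sum>k<n. of_real (e j i * e k i) * cinner (T i (v k)) (v j)) =
        cinner (T i (\<Sum>k<n. e k i *\<^sub>R v k)) (\<Sum>j<n. e j i *\<^sub>R v j)"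
      by (simp add: linear_sum linear_cmul cinner_sum_left cinner_sum_right cinner_scaleR_left cinner_scaleR_right
          sum_distrib_left mult.assoc)
  qed
  also have "\<dots> \<in> \<real>\<^sub>\<ge>\<^sub>0"
  proof (rule sum_in_nonneg_Reals)
    fix i assume "i \<in> I"
    then show "cinner (T i (\<Sum>k<n. e k i *\<^sub>R v k)) (\<Sum>j<n. e j i *\<^sub>R v j) \<in> \<real>\<^sub>\<ge>\<^sub>0"
      using T unfolding herm_pos_def by blast
  qed
  finally show ?thesis .
qed

text \<open>Number of the cell of mesh \<open>1 / Suc N\<close> containing \<open>l\<close>. The cap
  leaves finitely many cells, everything from \<open>Suc N\<close> on falling into the last
  one.\<close>

definition grid_index :: "nat \<Rightarrow> real \<Rightarrow> nat" where
  "grid_index N l = min (nat \<lfloor>real (Suc N) * l\<rfloor>) (Suc N * Suc N)"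

lemma measurable_grid_index [measurable]: "grid_index N \<in> measurable borel (count_space UNIV)"
  unfolding grid_index_def by measurable

text \<open>Once \<open>N\<close> is at least \<open>l\<close> the cap is inactive and the rounding
  error is at most \<open>1 / Suc N\<close>.\<close>

lemma grid_index_tendsto:
  assumes "0 \<le> l"
  shows "(\<lambda>N. real (grid_index N l) / real (Suc N)) \<longlonglongrightarrow> l"
proof (rule tendsto_sandwich[of "\<lambda>N. l - 1 / real (Suc N)" _ _ "\<lambda>_. l"])
  obtain m where m: "l \<le> real m" using real_arch_simple by blast
  have le: "l - 1 / real (Suc N) \<le> real (grid_index N l) / real (Suc N) \<and> real (grid_index N l) / real (Suc N) \<le> l"
    if N: "m \<le> N" for N
  proof -
    have "real (Suc N) * l \<le> real (Suc N) * real (Suc N)"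
      using m N by (intro mult_left_mono) auto
    then have "nat \<lfloor>real (Suc N) * l\<rfloor> \<le> Suc N * Suc N"
      by (metis floor_mono floor_of_nat nat_int nat_mono of_nat_mult)
    then have "real (grid_index N l) = real_of_int \<lfloor>real (Suc N) * l\<rfloor>"
      unfolding grid_index_def using assms by (simp add: min_absorb1)
    then have "real (Suc N) * l - 1 \<le> real (grid_index N l)" "real (grid_index N l) \<le> real (Suc N) * l"
      by linarith+
    then have "(real (Suc N) * l - 1) / real (Suc N) \<le> real (grid_index N l) / real (Suc N)"
      "real (grid_index N l) / real (Suc N) \<le> real (Suc N) * l / real (Suc N)"
      by (auto intro: divide_right_mono simp only: of_nat_0_le_iff)
    moreover have "real (Suc N) * l / real (Suc N) = l" by simp
    ultimately show ?thesis unfolding diff_divide_distrib by metis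
  qed
  show "\<forall>\<^sub>F N in sequentially. l - 1 / real (Suc N) \<le> real (grid_index N l) / real (Suc N)"
    using eventually_ge_at_top[of m] by eventually_elim (use le in blast)
  show "\<forall>\<^sub>F N in sequentially. real (grid_index N l) / real (Suc N) \<le> l"
    using eventually_ge_at_top[of m] by eventually_elim (use le in blast)
  have "(\<lambda>N. l - 1 / real (Suc N)) \<longlonglongrightarrow> l - 0"
    by (intro tendsto_intros LIMSEQ_Suc[OF lim_1_over_n])
  then show "(\<lambda>N. l - 1 / real (Suc N)) \<longlonglongrightarrow> l" by simp
qed simp

text \<open>The weak integral is given on the diagonal, where the finite sums converge by dominated
  convergence; polarization extends this to all matrix coefficients, and positivity survives the
  limit.\<close>

theorem laplace_transform_positive_definite_halfline:
  fixes \<phi> :: "real \<Rightarrow> 'f::complex_hilbert_space \<Rightarrow> 'f"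
  assumes Q: "herm_pos_measure (restrict_space borel {0..}) Q"
    and W: "\<And>x. has_weak_integral (restrict_space borel {0..}) Q (\<lambda>l. exp (- l * \<bar>x\<bar>)) (\<phi> x)"
  shows "positive_definite_halfline \<phi>"
  unfolding positive_definite_halfline_def
proof (intro allI impI)
  fix n :: nat and s :: "nat \<Rightarrow> real" and v :: "nat \<Rightarrow> 'f"
  assume s: "\<forall>j<n. 0 < s j"
  define M where "M = (restrict_space borel {0..} :: real measure)"
  have spM: "space M = {0..}" by (simp add: M_def space_restrict_space)
  note Q = Q[folded M_def] and W = W[folded M_def]
  define E where "E N i = grid_index N -` {i} \<inter> space M" for N i
  have gm: "grid_index N \<in> measurable M (count_space UNIV)" for N
    unfolding M_def by (rule measurable_restrict_space1) measurable
  have E: "E N i \<in> sets M" for N i unfolding E_def by (rule measurable_sets[OF gm]) simp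
  have QE: "Q (E N i) \<in> herm_pos" for N i using Q E by (simp add: herm_pos_measure_def)
  have lin: "bounded_clinear (Q (E N i))" for N i using QE by (auto simp: herm_pos_def)
  have lin\<phi>: "bounded_clinear (\<phi> x)" for x using W by (simp add: has_weak_integral_def)
  define T where "T N t x y = (\<Sum>i\<le>Suc N * Suc N. of_real (exp (- (real i / real (Suc N)) * t)) * cinner (Q (E N i) x) y)" for N t x y
  have T_diag: "(\<lambda>N. T N t u u) \<longlonglongrightarrow> cinner (\<phi> t u) u" if t: "0 < t" for t u
  proof -
    define \<mu> where "\<mu> = scalar_measure M Q u"
    interpret \<mu>: finite_measure \<mu> unfolding \<mu>_def by (rule finite_scalar_measure[OF Q])
    have sp: "space \<mu> = {0..}" and sets: "sets \<mu> = sets M"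
      unfolding \<mu>_def using space_scalar_measure[OF Q] sets_scalar_measure[OF Q] spM by auto
    have gm': "grid_index N \<in> measurable \<mu> (count_space UNIV)" for N
      using gm by (simp cong: measurable_cong_sets add: measurable_cong_sets[OF sets refl])
    have "T N t u u = of_real (\<integral>l. exp (- (real (grid_index N l) / real (Suc N)) * t) \<partial>\<mu>)" for N
    proof -
      have "(\<integral>l. exp (- (real (grid_index N l) / real (Suc N)) * t) \<partial>\<mu>) =
        (\<integral>l. (\<Sum>i\<le>Suc N * Suc N. exp (- (real i / real (Suc N)) * t) * indicator (E N i) l) \<partial>\<mu>)"
      proof (rule Bochner_Integration.integral_cong[OF refl])
        fix l assume l: "l \<in> space \<mu>"
        have "(\<Sum>i\<le>Suc N * Suc N. exp (- (real i / real (Suc N)) * t) * indicator (E N i) l) =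
          (\<Sum>i\<le>Suc N * Suc N. if grid_index N l = i then exp (- (real i / real (Suc N)) * t) else 0)"
          using l by (intro sum.cong refl) (auto simp: E_def sp spM)
        \<comment> \<open>The cap keeps the index within the range of summation, so exactly one
          summand survives.\<close>
        also have "\<dots> = exp (- (real (grid_index N l) / real (Suc N)) * t)"
          by (subst sum.delta') (auto simp: grid_index_def)
        finally show "exp (- (real (grid_index N l) / real (Suc N)) * t) =
          (\<Sum>i\<le>Suc N * Suc N. exp (- (real i / real (Suc N)) * t) * indicator (E N i) l)" ..
      qed
      also have "\<dots> = (\<Sum>i\<le>Suc N * Suc N. exp (- (real i / real (Suc N)) * t) * measure \<mu> (E N i))"
      proof (subst Bochner_Integration.integral_sum)
        have "E N i \<in> sets \<mu>" for i using E sets by simp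
        then show "integrable \<mu> (\<lambda>l. exp (- (real i / real (Suc N)) * t) * indicator (E N i) l)" for i
          by (intro integrable_mult_right integrable_real_indicator) (auto simp: \<mu>.emeasure_finite less_top[symmetric])
        show "(\<Sum>i\<le>Suc N * Suc N. \<integral>l. exp (- (real i / real (Suc N)) * t) * indicator (E N i) l \<partial>\<mu>) =
          (\<Sum>i\<le>Suc N * Suc N. exp (- (real i / real (Suc N)) * t) * measure \<mu> (E N i))"
          by (intro sum.cong refl) (simp add: E_def sp spM Int_absorb2)
      qed
      finally show ?thesis
        unfolding T_def \<mu>_def by (simp add: measure_scalar_measure[OF Q E])
    qed
    moreover have "(\<lambda>N. \<integral>l. exp (- (real (grid_index N l) / real (Suc N)) * t) \<partial>\<mu>) \<longlonglongrightarrow> (\<integral>l. exp (- l * t) \<partial>\<mu>)"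
    proof (rule integral_dominated_convergence[where w="\<lambda>_. 1"])
      show "(\<lambda>l. exp (- l * t)) \<in> borel_measurable \<mu>"
        unfolding measurable_cong_sets[OF sets refl] M_def by (intro measurable_restrict_space1) measurable
      show "(\<lambda>l. exp (- (real (grid_index N l) / real (Suc N)) * t)) \<in> borel_measurable \<mu>" for N
        by (rule measurable_compose[OF gm']) simp
      show "AE l in \<mu>. (\<lambda>N. exp (- (real (grid_index N l) / real (Suc N)) * t)) \<longlonglongrightarrow> exp (- l * t)"
      proof (rule AE_I2)
        fix l assume "l \<in> space \<mu>"
        then have "0 \<le> l" by (simp add: sp)
        then show "(\<lambda>N. exp (- (real (grid_index N l) / real (Suc N)) * t)) \<longlonglongrightarrow> exp (- l * t)"
          by (intro tendsto_exp tendsto_mult tendsto_minus tendsto_const grid_index_tendsto)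
      qed
      show "AE l in \<mu>. norm (exp (- (real (grid_index N l) / real (Suc N)) * t)) \<le> 1" for N
        by (rule AE_I2) (use t in simp)
    qed simp
    ultimately have "(\<lambda>N. T N t u u) \<longlonglongrightarrow> of_real (\<integral>l. exp (- l * t) \<partial>\<mu>)" by (simp add: tendsto_of_real)
    also have "of_real (\<integral>l. exp (- l * t) \<partial>\<mu>) = cinner (\<phi> t u) u"
      using W[of t] t by (simp add: has_weak_integral_def \<mu>_def)
    finally show ?thesis .
  qed
  have T_polar: "4 * T N t x y = T N t (x + y) (x + y) - T N t (x + (-1) *\<^sub>C y) (x + (-1) *\<^sub>C y)
     + \<i> * T N t (x + \<i> *\<^sub>C y) (x + \<i> *\<^sub>C y) - \<i> * T N t (x + (-\<i>) *\<^sub>C y) (x + (-\<i>) *\<^sub>C y)" for N t x y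
  proof -
    have "4 * T N t x y = (\<Sum>i\<le>Suc N * Suc N. of_real (exp (- (real i / real (Suc N)) * t)) * (4 * cinner (Q (E N i) x) y))"
      unfolding T_def sum_distrib_left by (simp add: mult.left_commute)
    then show ?thesis
      unfolding clinear_cinner_polarization[OF lin] T_def sum_distrib_left
        sum.distrib[symmetric] sum_subtractf[symmetric]
      by (simp add: algebra_simps)
  qed
  have T_lim: "(\<lambda>N. T N t x y) \<longlonglongrightarrow> cinner (\<phi> t x) y" if t: "0 < t" for t x y
  proof -
    have "(\<lambda>N. 4 * T N t x y) \<longlonglongrightarrow> 4 * cinner (\<phi> t x) y"
      unfolding T_polar clinear_cinner_polarization[OF lin\<phi>] by (intro tendsto_intros T_diag t)
    then have "(\<lambda>N. (1/4) * (4 * T N t x y)) \<longlonglongrightarrow> (1/4) * (4 * cinner (\<phi> t x) y)"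
      by (rule tendsto_mult_left)
    then show ?thesis by simp
  qed
  have lim: "(\<lambda>N. \<Sum>j<n. \<Sum>k<n. T N (s j + s k) (v k) (v j)) \<longlonglongrightarrow> (\<Sum>j<n. \<Sum>k<n. cinner (\<phi> (s j + s k) (v k)) (v j))"
    by (intro tendsto_sum T_lim) (use s in \<open>auto intro: add_pos_pos\<close>)
  have pos: "(\<Sum>j<n. \<Sum>k<n. T N (s j + s k) (v k) (v j)) \<in> \<real>\<^sub>\<ge>\<^sub>0" for N
  proof -
    \<comment> \<open>The exponential turns \<open>s j + s k\<close> into the product weight of
      \<open>herm_pos_sum_nonneg\<close>.\<close>
    have e: "exp (- (real i / real (Suc N)) * (s j + s k)) =
        exp (- (real i / real (Suc N)) * s j) * exp (- (real i / real (Suc N)) * s k)" for i j k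
      by (simp add: exp_add[symmetric] distrib_left del: of_nat_Suc)
    show ?thesis unfolding T_def e by (rule herm_pos_sum_nonneg) (rule QE)
  qed
  show "(\<Sum>j<n. \<Sum>k<n. cinner (\<phi> (s j + s k) (v k)) (v j)) \<in> \<real>\<^sub>\<ge>\<^sub>0"
    by (rule closed_sequentially[OF closed_nonneg_Reals_complex pos lim])
qed

theorem proposition3p1:
  fixes \<phi> :: "real \<Rightarrow> 'f::complex_hilbert_space \<Rightarrow> 'f"
  assumes "\<And>x. bounded_clinear (\<phi> x)"
    and "positive_definite \<phi>"
    and "strongly_continuous \<phi>"
  shows "reflection_positive \<phi> \<longleftrightarrow>
    (\<exists>Q :: real set \<Rightarrow> 'f \<Rightarrow> 'f.
       herm_pos_measure (restrict_space borel {0..}) Q \<and>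
       (\<forall>x. has_weak_integral (restrict_space borel {0..}) Q (\<lambda>l. exp (- l * \<bar>x\<bar>)) (\<phi> x)))"
proof
  assume "reflection_positive \<phi>"
  with assms(1,3) show "\<exists>Q :: real set \<Rightarrow> 'f \<Rightarrow> 'f.
       herm_pos_measure (restrict_space borel {0..}) Q \<and>
       (\<forall>x. has_weak_integral (restrict_space borel {0..}) Q (\<lambda>l. exp (- l * \<bar>x\<bar>)) (\<phi> x))"
    by (rule reflection_positive_imp_laplace_transform)
next
  assume "\<exists>Q :: real set \<Rightarrow> 'f \<Rightarrow> 'f.
       herm_pos_measure (restrict_space borel {0..}) Q \<and>
       (\<forall>x. has_weak_integral (restrict_space borel {0..}) Q (\<lambda>l. exp (- l * \<bar>x\<bar>)) (\<phi> x))"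
  then obtain Q :: "real set \<Rightarrow> 'f \<Rightarrow> 'f" where
    Q: "herm_pos_measure (restrict_space borel {0..}) Q" and
    W: "\<And>x. has_weak_integral (restrict_space borel {0..}) Q (\<lambda>l. exp (- l * \<bar>x\<bar>)) (\<phi> x)"
    by blast
  \<comment> \<open>The integrands for \<open>x\<close> and \<open>- x\<close> coincide, so both
    operators have the same diagonal coefficients.\<close>
  have "cinner (\<phi> (- x) v) v = cinner (\<phi> x v) v" for x v
    using W[of x] W[of "- x"] by (simp add: has_weak_integral_def)
  then have "\<phi> (- x) = \<phi> x" for x by (intro bounded_clinear_eqI assms(1))
  with assms(2) laplace_transform_positive_definite_halfline[OF Q W] show "reflection_positive \<phi>"
    by (simp add: reflection_positive_def)
qed

end
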